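(* Let $p \ge 2$ be a real number. Then for any positive semidefinite matrices $A$ and $B$ (of the same size), $$\operatorname{Tr}(|A^p - B^p|) \ \ge\ \operatorname{Tr}\big((A-B)(A^{p-1} - B^{p-1})\big) \ \ge\ \operatorname{Tr}(|A-B|^p).$$
   Context: Matrices are square complex matrices of an arbitrary finite size $n\times n$; positive semidefinite matrices are Hermitian. $\operatorname{Tr}$ is the usual (unnormalized) trace. For a matrix $X$, $|X| = (X^*X)^{1/2}$. Real powers of positive semidefinite matrices are defined by the functional calculus (spectral theorem). *)

theory Defs
  imports "HOL-Analysis.Analysis"
begin

definition conj_transpose :: "complex^'n^'m \<Rightarrow> complex^'m^'n"
  where "conj_transpose A = map_matrix cnj (transpose A)"

definition hermitian :: "complex^'n^'n \<Rightarrow> bool"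
  where "hermitian A \<longleftrightarrow> conj_transpose A = A"

definition unitary :: "complex^'n^'n \<Rightarrow> bool"
  where "unitary U \<longleftrightarrow> U ** conj_transpose U = mat 1 \<and> conj_transpose U ** U = mat 1"

text \<open>The order on \<^typ>\<open>complex\<close> is the one of \<^theory>\<open>HOL-Library.Complex_Order\<close>:
  \<open>z \<le> w\<close> iff \<open>w - z\<close> is a nonnegative real number.\<close>

definition positive_semidefinite :: "complex^'n^'n \<Rightarrow> bool"
  where "positive_semidefinite A \<longleftrightarrow>
    hermitian A \<and> (\<forall>x. 0 \<le> (\<Sum>i\<in>UNIV. cnj (x $ i) * (A *v x) $ i))"

definition real_diag :: "('n \<Rightarrow> real) \<Rightarrow> complex^'n^'n"
  where "real_diag d = (\<chi> i j. if i = j then complex_of_real (d i) else 0)"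

text \<open>\<open>spectral_decomposition A U d\<close>: the columns of \<open>U\<close> form an orthonormal basis of
  eigenvectors of \<open>A\<close>, with the real eigenvalues \<open>d\<close>.\<close>

definition spectral_decomposition :: "complex^'n^'n \<Rightarrow> complex^'n^'n \<Rightarrow> ('n \<Rightarrow> real) \<Rightarrow> bool"
  where "spectral_decomposition A U d \<longleftrightarrow>
    unitary U \<and> A = U ** real_diag d ** conj_transpose U"

text \<open>Functional calculus for Hermitian \<open>A\<close>. A decomposition exists by the spectral theorem, and
  the result does not depend on it (lemma \<open>hermitian_fun_eq\<close> below); for \<open>A\<close> not Hermitian the
  value is unspecified.\<close>

definition hermitian_fun :: "(real \<Rightarrow> real) \<Rightarrow> complex^'n^'n \<Rightarrow> complex^'n^'n"
  where "hermitian_fun f A =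
    (THE X. \<exists>U d. spectral_decomposition A U d \<and>
       X = U ** real_diag (\<lambda>i. f (d i)) ** conj_transpose U)"

text \<open>Real powers are used for positive semidefinite \<open>A\<close> and exponent \<open>a > 0\<close>. Note that
  \<open>0 powr a = 0\<close> in HOL, so zero eigenvalues are treated correctly.\<close>

definition mat_powr :: "complex^'n^'n \<Rightarrow> real \<Rightarrow> complex^'n^'n"
  where "mat_powr A a = hermitian_fun (\<lambda>t. t powr a) A"

definition mat_abs :: "complex^'n^'n \<Rightarrow> complex^'n^'n"
  where "mat_abs X = mat_powr (conj_transpose X ** X) (1 / 2)"

lemma real_diag_mult_left: "(real_diag d ** M) $ i $ j = of_real (d i) * M $ i $ j"
  by (simp add: real_diag_def matrix_matrix_mult_def if_distrib [of "\<lambda>x. x * _"] cong: if_cong)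

lemma real_diag_mult_right: "(M ** real_diag d) $ i $ j = M $ i $ j * of_real (d j)"
  by (simp add: real_diag_def matrix_matrix_mult_def if_distrib [of "\<lambda>x. _ * x"] cong: if_cong)

lemma spectral_decomposition_unique:
  assumes "spectral_decomposition A U d" and "spectral_decomposition A V e"
  shows "U ** real_diag (\<lambda>i. f (d i)) ** conj_transpose U =
    V ** real_diag (\<lambda>i. f (e i)) ** conj_transpose V"
proof -
  define W where "W = conj_transpose V ** U"
  have U: "U ** conj_transpose U = mat 1" "conj_transpose U ** U = mat 1"
    and V: "V ** conj_transpose V = mat 1" "conj_transpose V ** V = mat 1"
    and eq: "U ** real_diag d ** conj_transpose U = V ** real_diag e ** conj_transpose V"
    using assms by (auto simp: spectral_decomposition_def unitary_def)
  have "W ** real_diag d =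
      conj_transpose V ** (U ** real_diag d ** conj_transpose U) ** U"
    by (simp add: W_def U flip: matrix_mul_assoc)
  also have "\<dots> = (conj_transpose V ** V) ** real_diag e ** W"
    by (simp only: eq W_def matrix_mul_assoc)
  finally have "W ** real_diag d = real_diag e ** W"
    by (simp add: V)
  then have "W $ i $ j * of_real (d j) = of_real (e i) * W $ i $ j" for i j
    by (metis real_diag_mult_left real_diag_mult_right)
  then have "W $ i $ j = 0 \<or> d j = e i" for i j
    by (metis mult.commute mult_cancel_left of_real_eq_iff)
  then have "W $ i $ j * of_real (f (d j)) = of_real (f (e i)) * W $ i $ j" for i j
    by (metis mult.commute mult_zero_left)
  then have W: "W ** real_diag (\<lambda>i. f (d i)) = real_diag (\<lambda>i. f (e i)) ** W"
    by (simp add: vec_eq_iff real_diag_mult_left real_diag_mult_right)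
  have "U ** real_diag (\<lambda>i. f (d i)) ** conj_transpose U =
      V ** (W ** real_diag (\<lambda>i. f (d i))) ** conj_transpose U"
    by (simp add: W_def matrix_mul_assoc V)
  also have "\<dots> = V ** real_diag (\<lambda>i. f (e i)) ** conj_transpose V ** (U ** conj_transpose U)"
    unfolding W by (simp only: W_def matrix_mul_assoc)
  finally show ?thesis
    by (simp add: U)
qed

lemma hermitian_fun_eq:
  assumes "spectral_decomposition A U d"
  shows "hermitian_fun f A = U ** real_diag (\<lambda>i. f (d i)) ** conj_transpose U"
  unfolding hermitian_fun_def
  using assms spectral_decomposition_unique by (intro the_equality) blast+

end

theory Submission
  imports Defs
begin

text \<open>
  Write \<open>D = A - B = P - N\<close> with \<open>P\<close> and \<open>N\<close> the positive and negative parts of \<open>D\<close>. Two tools carry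
  the proof. One is Klein's principle (\<open>klein_inequality\<close>): a trace of the form
  \<open>Tr f(A) g(B)\<close> is a double sum over pairs of eigenvalues with nonnegative weights, so scalar inequalities
  between sums of products \<open>f(s) g(t)\<close> become trace inequalities. The other is comparison with a
  common upper bound: \<open>A + N = B + P\<close> dominates both \<open>A\<close> and \<open>B\<close>, and operator monotone functions
  (powers with exponent below one, and negated resolvents) respect this order. Both rest on the spectral
  theorem for Hermitian matrices.

  The upper bound holds because the middle term equals
  \<open>(Tr X - Tr Y\<^sup>s X\<^sup>1\<^sup>-\<^sup>s) + (Tr Y - Tr X\<^sup>s Y\<^sup>1\<^sup>-\<^sup>s)\<close> for \<open>X = A\<^sup>p\<close>, \<open>Y = B\<^sup>p\<close>, \<open>s = 1/p\<close>, and by Audenaert's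
  inequality (\<open>trace_minus_powr_mult_le_pos_part\<close>) the brackets are at most the traces of the
  positive and negative parts of \<open>X - Y\<close>. That inequality is a short consequence of
  the Loewner--Heinz theorem (\<open>loewner_heinz\<close>).

  For the lower bound put \<open>r = p - 2\<close>. If \<open>r \<ge> 1\<close>, then \<open>t\<^sup>r\<close> is convex: Klein's principle
  bounds the middle term below by \<open>Tr D\<^sup>2 (A\<^sup>r + B\<^sup>r)\<close>, hence by \<open>Tr P\<^sup>2 A\<^sup>r + Tr N\<^sup>2 B\<^sup>r\<close>, and since \<open>A\<close> exceeds \<open>D\<close>
  and \<open>B\<close> exceeds \<open>- D\<close>, tangent lines show that this is at least \<open>Tr P\<^sup>p + Tr N\<^sup>p\<close>
  (\<open>trace_pos_part_square_mult_powr_ge\<close>). If \<open>0 < r < 1\<close>, the convexity fails, but \<open>t\<^sup>r\<close> is a positive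
  mixture of the functions \<open>t / (t + l)\<close>, and the claim reduces to a resolvent inequality
  for each \<open>l > 0\<close> (\<open>trace_resolvent_diff_le\<close>), where the common upper bound is available.
  For \<open>r = 0\<close> both sides are \<open>Tr D\<^sup>2\<close>.
\<close>

section \<open>The spectral theorem for Hermitian matrices\<close>

definition cdot :: "complex^'n \<Rightarrow> complex^'n \<Rightarrow> complex"
  where "cdot x y = (\<Sum>i\<in>UNIV. cnj (x $ i) * y $ i)"

lemma cdot_add_right: "cdot x (y + z) = cdot x y + cdot x z"
  by (simp add: cdot_def sum.distrib algebra_simps)

lemma cdot_scaleR_right: "cdot x (r *\<^sub>R y) = r *\<^sub>R cdot x y"
  by (simp add: cdot_def scaleR_sum_right)

lemma cdot_scaleR_left: "cdot (r *\<^sub>R x) y = r *\<^sub>R cdot x y"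
  by (simp add: cdot_def scaleR_sum_right)

lemma cnj_cdot: "cnj (cdot x y) = cdot y x"
  by (simp add: cdot_def mult.commute)

lemma Re_cdot: "Re (cdot x y) = x \<bullet> y"
  by (simp add: cdot_def inner_vec_def inner_complex_def)

lemma cdot_self: "cdot x x = of_real ((norm x)\<^sup>2)"
proof (rule complex_eqI)
  show "Re (cdot x x) = Re (of_real ((norm x)\<^sup>2))"
    by (simp add: Re_cdot dot_square_norm)
  have "Im (cdot x x) = - Im (cdot x x)"
    using arg_cong[OF cnj_cdot[of x x], of Im] by simp
  then show "Im (cdot x x) = Im (of_real ((norm x)\<^sup>2))" by simp
qed

lemma conj_transpose_nth: "conj_transpose A $ i $ j = cnj (A $ j $ i)"
  by (simp add: conj_transpose_def transpose_def map_matrix_def)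

lemma cdot_adjoint: "cdot x (A *v y) = cdot (conj_transpose A *v x) y"
proof -
  have "cdot x (A *v y) = (\<Sum>i\<in>UNIV. \<Sum>j\<in>UNIV. cnj (x $ i) * (A $ i $ j * y $ j))"
    by (simp add: cdot_def matrix_vector_mult_def sum_distrib_left)
  also have "\<dots> = (\<Sum>j\<in>UNIV. \<Sum>i\<in>UNIV. cnj (x $ i) * (A $ i $ j * y $ j))"
    by (rule sum.swap)
  also have "\<dots> = cdot (conj_transpose A *v x) y"
    by (simp add: cdot_def matrix_vector_mult_def sum_distrib_right conj_transpose_nth)
      (simp only: mult_ac)
  finally show ?thesis .
qed

lemma cdot_hermitian: "hermitian A \<Longrightarrow> cdot x (A *v y) = cdot (A *v x) y"
  by (metis cdot_adjoint hermitian_def)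

lemma inner_hermitian: "hermitian A \<Longrightarrow> x \<bullet> (A *v y) = (A *v x) \<bullet> y"
  by (metis cdot_hermitian Re_cdot)

lemma matrix_vector_scaleR_right: "(A :: complex^'n^'m) *v (r *\<^sub>R x) = r *\<^sub>R (A *v x)"
  by (simp add: vec_eq_iff matrix_vector_mult_def scaleR_sum_right)

lemma continuous_on_cdot: "continuous_on S (cdot u)"
  unfolding cdot_def by (intro continuous_intros)

lemma continuous_on_matrix_vector: "continuous_on S ((*v) (A :: complex^'n^'m))"
  unfolding matrix_vector_mult_def by (intro continuous_intros)

text \<open>Fewer than \<open>n\<close> linear conditions on \<open>n\<close> unknowns have a nonzero solution: the square matrix of
  the conditions \<open>cdot (u i) x = 0\<close>, padded with zero rows, has determinant zero.\<close>

lemma exists_orthogonal_vector: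
  fixes u :: "'n \<Rightarrow> complex^'n"
  assumes "S \<noteq> UNIV"
  shows "\<exists>x. norm x = 1 \<and> (\<forall>i\<in>S. cdot (u i) x = 0)"
proof -
  obtain k where k: "k \<notin> S" using assms by blast
  define M :: "complex^'n^'n" where "M = (\<chi> i. if i \<in> S then (\<chi> j. cnj (u i $ j)) else 0)"
  have "row k M = 0" using k by (simp add: row_def M_def vec_eq_iff)
  then have "det M = 0" by (rule det_zero_row)
  then have "\<not> invertible M" by (simp add: invertible_det_nz)
  then obtain x where x: "M *v x = 0" "x \<noteq> 0"
    using matrix_left_invertible_ker[of M] invertible_left_inverse[of M] by blast
  have ux: "cdot (u i) x = 0" if "i \<in> S" for i
    using x(1)[unfolded vec_eq_iff, rule_format, of i] that
    by (simp add: M_def matrix_vector_mult_def cdot_def)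
  show ?thesis
    by (rule exI[of _ "(1 / norm x) *\<^sub>R x"]) (use x ux in \<open>simp add: cdot_scaleR_right\<close>)
qed

text \<open>The orthogonal complement of a family of eigenvectors is invariant under a Hermitian matrix, and
  a maximum point of the Rayleigh quotient on the unit sphere of the complement is an eigenvector.\<close>

lemma exists_orthogonal_eigenvector:
  fixes A :: "complex^'n^'n" and u :: "'n \<Rightarrow> complex^'n"
  assumes A: "hermitian A" and S: "S \<noteq> UNIV"
    and eig: "\<And>i. i \<in> S \<Longrightarrow> A *v u i = d i *\<^sub>R u i"
  shows "\<exists>x m. norm x = 1 \<and> (\<forall>i\<in>S. cdot (u i) x = 0) \<and> A *v x = m *\<^sub>R x"
proof -
  define V where "V = {x. \<forall>i\<in>S. cdot (u i) x = 0}"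
  define W where "W = {x. norm x = 1} \<inter> V"
  have V_eq: "V = (\<Inter>i\<in>S. {x. cdot (u i) x = 0})"
    by (auto simp: V_def)
  have "closed V" unfolding V_eq
    by (intro closed_INT ballI closed_Collect_eq continuous_on_cdot continuous_on_const)
  then have "compact W" unfolding W_def
    using compact_Int_closed[OF compact_sphere[of 0 1]] by (simp add: sphere_def)
  moreover have "W \<noteq> {}"
    using exists_orthogonal_vector[OF S, of u] by (auto simp: W_def V_def)
  moreover have "continuous_on W (\<lambda>x. x \<bullet> (A *v x))"
    by (intro continuous_intros continuous_on_matrix_vector)
  ultimately obtain x where x: "x \<in> W" and max: "\<And>y. y \<in> W \<Longrightarrow> y \<bullet> (A *v y) \<le> x \<bullet> (A *v x)"
    using continuous_attains_sup by metis
  define m where "m = x \<bullet> (A *v x)"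
  have nx: "norm x = 1" and xV: "x \<in> V" using x by (auto simp: W_def)
  have V_add: "y + t *\<^sub>R z \<in> V" if "y \<in> V" "z \<in> V" for y z t
    using that by (simp add: V_def cdot_add_right cdot_scaleR_right)
  have AV: "A *v y \<in> V" if "y \<in> V" for y
    using that by (auto simp: V_def cdot_hermitian[OF A] eig cdot_scaleR_left)
  have le: "y \<bullet> (A *v y) \<le> m * (y \<bullet> y)" if "y \<in> V" for y
  proof (cases "y = 0")
    case False
    have "(1 / norm y) *\<^sub>R y \<in> W"
      using that False by (simp add: W_def V_def cdot_scaleR_right)
    from max[OF this] show ?thesis
      using False
      by (simp add: m_def matrix_vector_scaleR_right field_simps dot_square_norm power2_eq_square)
  qed simp
  \<comment> \<open>The residual \<open>z\<close> lies in \<open>V\<close> again, so moving from \<open>x\<close> in its direction cannot raise the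
    Rayleigh quotient; the first-order term of this comparison is \<open>z \<bullet> z\<close>.\<close>
  define z where "z = A *v x - m *\<^sub>R x"
  have zV: "z \<in> V"
    using V_add[OF AV[OF xV] xV, of "- m"] by (simp add: z_def)
  define c where "c = m * (z \<bullet> z) - z \<bullet> (A *v z)"
  have main: "2 * t * (z \<bullet> z) \<le> t\<^sup>2 * c" for t
  proof -
    have le1: "(x + t *\<^sub>R z) \<bullet> (A *v (x + t *\<^sub>R z)) \<le> m * ((x + t *\<^sub>R z) \<bullet> (x + t *\<^sub>R z))"
      by (intro le V_add xV zV)
    have eq1: "(x + t *\<^sub>R z) \<bullet> (A *v (x + t *\<^sub>R z)) =
        m + t * (x \<bullet> (A *v z)) + t * (z \<bullet> (A *v x)) + t\<^sup>2 * (z \<bullet> (A *v z))"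
      by (simp add: matrix_vector_right_distrib matrix_vector_scaleR_right inner_add_left inner_add_right
          m_def distrib_left power2_eq_square)
    have eq2: "(x + t *\<^sub>R z) \<bullet> (x + t *\<^sub>R z) = 1 + 2 * t * (x \<bullet> z) + t\<^sup>2 * (z \<bullet> z)"
      using nx by (simp add: inner_add_left inner_add_right inner_commute[of z x] dot_square_norm[of x]
          distrib_left power2_eq_square)
    have eq3: "x \<bullet> (A *v z) = z \<bullet> (A *v x)"
      by (metis inner_hermitian[OF A] inner_commute)
    have eq4: "z \<bullet> (A *v x) = z \<bullet> z + m * (x \<bullet> z)"
    proof -
      have "A *v x = z + m *\<^sub>R x" by (simp add: z_def)
      then show ?thesis by (simp add: inner_add_right inner_commute)
    qed
    from le1 show ?thesis
      unfolding eq1 eq2 eq3 eq4 by (simp add: c_def algebra_simps)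
  qed
  have "z \<bullet> z = 0"
  proof (rule ccontr)
    assume "z \<bullet> z \<noteq> 0"
    then have zz: "z \<bullet> z > 0" by simp
    \<comment> \<open>This \<open>t\<close> is small enough for the first-order term to dominate the second-order one.\<close>
    define t where "t = (z \<bullet> z) / (\<bar>c\<bar> + 1)"
    have t: "t > 0" using zz by (simp add: t_def)
    have "t * c \<le> t * (\<bar>c\<bar> + 1)" using t by (intro mult_left_mono) auto
    also have "\<dots> = z \<bullet> z" by (simp add: t_def)
    finally have "t * (t * c) \<le> t * (z \<bullet> z)" using t by simp
    with main[of t] have "t * (z \<bullet> z) \<le> 0" by (simp add: power2_eq_square mult.assoc)
    with mult_pos_pos[OF t zz] show False by simp
  qed
  then have "A *v x = m *\<^sub>R x" by (simp add: z_def)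
  with nx xV show ?thesis by (auto simp: V_def)
qed

theorem spectral_theorem:
  fixes A :: "complex^'n^'n"
  assumes A: "hermitian A"
  shows "\<exists>U d. spectral_decomposition A U d"
proof -
  have "\<exists>u d. (\<forall>i\<in>S. \<forall>j\<in>S. cdot (u i) (u j) = (if i = j then 1 else 0)) \<and>
      (\<forall>i\<in>S. A *v u i = d i *\<^sub>R u i)" for S :: "'n set"
  proof (induction S rule: finite_induct[OF finite])
    case (2 k S)
    then obtain u d where on: "\<forall>i\<in>S. \<forall>j\<in>S. cdot (u i) (u j) = (if i = j then 1 else 0)"
      and eig: "\<forall>i\<in>S. A *v u i = d i *\<^sub>R u i" by blast
    have "S \<noteq> UNIV" using 2 by blast
    from exists_orthogonal_eigenvector[OF A this] eig
    obtain x m where x: "norm x = 1" "\<forall>i\<in>S. cdot (u i) x = 0" "A *v x = m *\<^sub>R x" by blast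
    have "cdot x x = 1" using x(1) by (simp add: cdot_self)
    moreover have "\<forall>i\<in>S. cdot x (u i) = 0" using x(2) by (metis cnj_cdot complex_cnj_zero)
    moreover have "k \<notin> S" using 2 by simp
    ultimately show ?case using on eig x
      by (intro exI[of _ "u(k := x)"] exI[of _ "d(k := m)"]) auto
  qed simp
  from this[of UNIV] obtain u :: "'n \<Rightarrow> complex^'n" and d where
    on: "\<And>i j. cdot (u i) (u j) = (if i = j then 1 else 0)"
    and eig: "\<And>i. A *v u i = d i *\<^sub>R u i" by auto
  define U :: "complex^'n^'n" where "U = (\<chi> i j. u j $ i)"
  have 1: "conj_transpose U ** U = mat 1"
    using on by (simp add: vec_eq_iff matrix_matrix_mult_def conj_transpose_nth U_def mat_def cdot_def)
  then have 2: "U ** conj_transpose U = mat 1"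
    by (simp add: matrix_left_right_inverse)
  have "(A ** U) $ i $ j = (U ** real_diag d) $ i $ j" for i j
    using eig[of j, unfolded vec_eq_iff, rule_format, of i]
    unfolding real_diag_mult_right
    by (simp add: matrix_matrix_mult_def matrix_vector_mult_def U_def
        scaleR_conv_of_real[where 'a=complex] mult.commute)
  then have "A ** U = U ** real_diag d" by (simp add: vec_eq_iff)
  then have "A = U ** real_diag d ** conj_transpose U"
    by (metis 2 matrix_mul_assoc matrix_mul_rid)
  with 1 2 show ?thesis by (auto simp: spectral_decomposition_def unitary_def)
qed

section \<open>Functional calculus and the semidefinite order\<close>

lemma matrix_mult_diff_left: "(A - B) ** C = A ** C - B ** (C :: complex^'n^'m)"
  by (simp add: vec_eq_iff matrix_matrix_mult_def sum_subtractf left_diff_distrib)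

lemma matrix_mult_diff_right: "C ** (A - B) = C ** A - C ** (B :: complex^'n^'m)"
  by (simp add: vec_eq_iff matrix_matrix_mult_def sum_subtractf right_diff_distrib)

lemma matrix_mult_add_left: "(A + B) ** C = A ** C + B ** (C :: complex^'n^'m)"
  by (simp add: vec_eq_iff matrix_matrix_mult_def sum.distrib distrib_right)

lemma matrix_mult_scaleR_right: "A ** (c *\<^sub>R B) = c *\<^sub>R (A ** (B :: complex^'n^'m))"
  by (simp add: vec_eq_iff matrix_matrix_mult_def scaleR_sum_right)

lemma conj_transpose_mult: "conj_transpose (A ** B) = conj_transpose B ** conj_transpose A"
  by (simp add: vec_eq_iff matrix_matrix_mult_def conj_transpose_nth mult.commute)

lemma matrix_vector_scaleR_left: "(c *\<^sub>R A) *v x = c *\<^sub>R (A *v (x :: complex^'n))"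
  by (simp add: vec_eq_iff matrix_vector_mult_def scaleR_sum_right)

lemma conj_transpose_conj_transpose [simp]: "conj_transpose (conj_transpose A) = A"
  by (simp add: vec_eq_iff conj_transpose_nth)

lemma conj_transpose_real_diag [simp]: "conj_transpose (real_diag d) = real_diag d"
  by (simp add: vec_eq_iff conj_transpose_nth real_diag_def)

lemma hermitian_add: "hermitian A \<Longrightarrow> hermitian B \<Longrightarrow> hermitian (A + B)"
  by (simp add: hermitian_def vec_eq_iff conj_transpose_nth)

lemma hermitian_diff: "hermitian A \<Longrightarrow> hermitian B \<Longrightarrow> hermitian (A - B)"
  by (simp add: hermitian_def vec_eq_iff conj_transpose_nth)

lemma trace_conj_transpose: "trace (conj_transpose A) = cnj (trace A)"
  by (simp add: trace_def conj_transpose_nth)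

lemma Im_trace_hermitian: "hermitian A \<Longrightarrow> Im (trace A) = 0"
  using arg_cong[OF trace_conj_transpose[of A], of Im] by (simp add: hermitian_def)

lemma Im_trace_hermitian_mult:
  assumes "hermitian A" "hermitian B" shows "Im (trace (A ** B)) = 0"
  using assms arg_cong[OF trace_conj_transpose[of "A ** B"], of Im] trace_mul_sym[of A B]
  by (simp add: hermitian_def conj_transpose_mult)

lemma hermitian_psd: "positive_semidefinite A \<Longrightarrow> hermitian A"
  by (simp add: positive_semidefinite_def)

text \<open>For Hermitian \<open>A\<close> the number \<open>cdot x (A *v x)\<close> is automatically real, so semidefiniteness can be
  tested with the inner product of \<^typ>\<open>complex^'n\<close> as a real Euclidean space.\<close>

lemma positive_semidefinite_iff:
  "positive_semidefinite A \<longleftrightarrow> hermitian A \<and> (\<forall>x. 0 \<le> x \<bullet> (A *v x))"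
proof -
  have "0 \<le> cdot x (A *v x) \<longleftrightarrow> 0 \<le> x \<bullet> (A *v x)" if "hermitian A" for x
  proof -
    have "cnj (cdot x (A *v x)) = cdot x (A *v x)"
      by (metis that cdot_hermitian cnj_cdot)
    from arg_cong[OF this, of Im] show ?thesis
      by (simp add: less_eq_complex_def Re_cdot)
  qed
  then show ?thesis
    by (auto simp: positive_semidefinite_def cdot_def)
qed

lemma psd_add:
  "positive_semidefinite A \<Longrightarrow> positive_semidefinite B \<Longrightarrow> positive_semidefinite (A + B)"
  by (simp add: positive_semidefinite_iff hermitian_add matrix_vector_mult_add_rdistrib inner_add_right)

lemma psd_zero: "positive_semidefinite 0"
  by (simp add: positive_semidefinite_iff hermitian_def vec_eq_iff conj_transpose_nth)

lemma psd_scaleR: "positive_semidefinite A \<Longrightarrow> 0 \<le> c \<Longrightarrow> positive_semidefinite (c *\<^sub>R A)"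
  by (simp add: positive_semidefinite_iff hermitian_def vec_eq_iff conj_transpose_nth
      matrix_vector_scaleR_left)

lemma spectral_decomposition_fun:
  assumes "spectral_decomposition A U d"
  shows "spectral_decomposition (hermitian_fun f A) U (\<lambda>i. f (d i))"
  using assms hermitian_fun_eq[OF assms] by (simp add: spectral_decomposition_def)

lemma hermitian_hermitian_fun:
  assumes "hermitian A" shows "hermitian (hermitian_fun f A)"
proof -
  obtain U d where "spectral_decomposition A U d" using spectral_theorem[OF assms] by blast
  then show ?thesis
    by (simp add: hermitian_def hermitian_fun_eq conj_transpose_mult matrix_mul_assoc)
qed

lemma hermitian_fun_comp:
  assumes "hermitian A"
  shows "hermitian_fun f (hermitian_fun g A) = hermitian_fun (\<lambda>t. f (g t)) A"
proof -
  obtain U d where sd: "spectral_decomposition A U d" using spectral_theorem[OF assms] by blast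
  show ?thesis
    by (rule trans[OF hermitian_fun_eq[OF spectral_decomposition_fun[OF sd]]
          hermitian_fun_eq[OF sd, symmetric]])
qed

lemma hermitian_fun_id:
  assumes "hermitian A" shows "hermitian_fun (\<lambda>t. t) A = A"
proof -
  obtain U d where sd: "spectral_decomposition A U d" using spectral_theorem[OF assms] by blast
  then have "A = U ** real_diag d ** conj_transpose U" by (simp only: spectral_decomposition_def)
  with hermitian_fun_eq[OF sd] show ?thesis by (rule trans[OF _ sym])
qed

lemma hermitian_fun_const:
  fixes A :: "complex^'n^'n"
  assumes "hermitian A" shows "hermitian_fun (\<lambda>_. c) A = real_diag (\<lambda>_. c)"
proof -
  obtain U d where sd: "spectral_decomposition A U d" using spectral_theorem[OF assms] by blast
  have "U ** real_diag (\<lambda>_. c) = real_diag (\<lambda>_. c) ** U"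
    by (simp add: vec_eq_iff real_diag_mult_left real_diag_mult_right mult.commute)
  then have "hermitian_fun (\<lambda>_. c) A = real_diag (\<lambda>_. c) ** (U ** conj_transpose U)"
    by (simp add: hermitian_fun_eq[OF sd] matrix_mul_assoc)
  with sd show ?thesis by (simp add: spectral_decomposition_def unitary_def)
qed

lemma hermitian_fun_one:
  fixes A :: "complex^'n^'n"
  assumes "hermitian A" shows "hermitian_fun (\<lambda>t. 1) A = mat 1"
  unfolding hermitian_fun_const[OF assms] by (simp add: real_diag_def mat_def vec_eq_iff)

lemma hermitian_fun_mult:
  assumes "hermitian A"
  shows "hermitian_fun f A ** hermitian_fun g A = hermitian_fun (\<lambda>t. f t * g t) A"
proof -
  obtain U d where sd: "spectral_decomposition A U d" using spectral_theorem[OF assms] by blast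
  have "real_diag (\<lambda>i. f (d i)) ** real_diag (\<lambda>i. g (d i)) = real_diag (\<lambda>i. f (d i) * g (d i))"
    by (simp add: vec_eq_iff real_diag_mult_left) (simp add: real_diag_def)
  moreover have "conj_transpose U ** U = mat 1"
    using sd by (simp add: spectral_decomposition_def unitary_def)
  moreover have "hermitian_fun f A ** hermitian_fun g A =
      U ** (real_diag (\<lambda>i. f (d i)) ** (conj_transpose U ** U) ** real_diag (\<lambda>i. g (d i))) **
        conj_transpose U"
    by (simp add: hermitian_fun_eq[OF sd] matrix_mul_assoc)
  ultimately show ?thesis
    by (simp add: hermitian_fun_eq[OF sd])
qed

lemma hermitian_fun_id_mult:
  assumes "hermitian A" shows "A ** hermitian_fun f A = hermitian_fun (\<lambda>t. t * f t) A"
  using hermitian_fun_mult[OF assms, of "\<lambda>t. t" f] unfolding hermitian_fun_id[OF assms] .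

lemma hermitian_fun_mult_id:
  assumes "hermitian A" shows "hermitian_fun f A ** A = hermitian_fun (\<lambda>t. f t * t) A"
  using hermitian_fun_mult[OF assms, of f "\<lambda>t. t"] unfolding hermitian_fun_id[OF assms] .

lemma hermitian_fun_add:
  assumes "hermitian A"
  shows "hermitian_fun f A + hermitian_fun g A = hermitian_fun (\<lambda>t. f t + g t) A"
proof -
  obtain U d where sd: "spectral_decomposition A U d" using spectral_theorem[OF assms] by blast
  have "real_diag (\<lambda>i. f (d i)) + real_diag (\<lambda>i. g (d i)) = real_diag (\<lambda>i. f (d i) + g (d i))"
    by (simp add: vec_eq_iff real_diag_def)
  then show ?thesis
    by (simp add: hermitian_fun_eq[OF sd] flip: matrix_mult_add_left matrix_add_ldistrib)
qed

lemma hermitian_fun_diff: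
  assumes "hermitian A"
  shows "hermitian_fun f A - hermitian_fun g A = hermitian_fun (\<lambda>t. f t - g t) A"
proof -
  have "hermitian_fun (\<lambda>t. f t - g t) A + hermitian_fun g A = hermitian_fun f A"
    by (simp add: hermitian_fun_add[OF assms])
  then show ?thesis by (simp add: diff_eq_eq)
qed

lemma hermitian_fun_scale:
  assumes "hermitian A"
  shows "hermitian_fun (\<lambda>t. c * f t) A = c *\<^sub>R hermitian_fun f A"
proof -
  obtain U d where sd: "spectral_decomposition A U d" using spectral_theorem[OF assms] by blast
  show ?thesis
    unfolding hermitian_fun_eq[OF sd]
    by (simp add: vec_eq_iff matrix_matrix_mult_def[of _ "conj_transpose U"] real_diag_mult_right
        scaleR_sum_right sum_distrib_left scaleR_conv_of_real[where 'a=complex] mult_ac)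
qed

lemma hermitian_fun_uminus:
  assumes h: "hermitian D" shows "hermitian_fun f (- D) = hermitian_fun (\<lambda>t. f (- t)) D"
proof -
  have "hermitian_fun (\<lambda>t. (- 1) * t) D = (- 1) *\<^sub>R D"
    unfolding hermitian_fun_scale[OF h] hermitian_fun_id[OF h] ..
  then have "- D = hermitian_fun (\<lambda>t. - t) D" by simp
  then show ?thesis by (simp add: hermitian_fun_comp[OF h])
qed

lemma inner_hermitian_fun:
  assumes "spectral_decomposition A U d"
  shows "x \<bullet> (hermitian_fun f A *v x) =
    (\<Sum>i\<in>UNIV. f (d i) * (cmod ((conj_transpose U *v x) $ i))\<^sup>2)"
proof -
  define y where "y = conj_transpose U *v x"
  have "x \<bullet> (hermitian_fun f A *v x) = Re (cdot x (U *v (real_diag (\<lambda>i. f (d i)) *v y)))"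
    by (simp add: Re_cdot hermitian_fun_eq[OF assms] y_def matrix_vector_mul_assoc matrix_mul_assoc)
  also have "\<dots> = Re (cdot y (real_diag (\<lambda>i. f (d i)) *v y))"
    by (simp add: cdot_adjoint y_def)
  also have "\<dots> = (\<Sum>i\<in>UNIV. Re (cnj (y $ i) * (of_real (f (d i)) * y $ i)))"
    by (simp add: cdot_def real_diag_def matrix_vector_mult_def if_distrib[of "\<lambda>x. x * _"] cong: if_cong)
  also have "\<dots> = (\<Sum>i\<in>UNIV. f (d i) * (cmod (y $ i))\<^sup>2)"
    unfolding cmod_power2
    by (intro sum.cong refl) (simp add: power2_eq_square algebra_simps)
  finally show ?thesis by (simp add: y_def)
qed

text \<open>Evaluate the quadratic form at the \<open>i\<close>-th eigenvector, which is the \<open>i\<close>-th column of \<open>U\<close>.\<close>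

lemma spectrum_psd:
  assumes A: "positive_semidefinite A" and sd: "spectral_decomposition A U d"
  shows "0 \<le> d i"
proof -
  define x where "x = U *v axis i 1"
  have "conj_transpose U *v x = axis i 1"
    using sd by (simp add: x_def matrix_vector_mul_assoc spectral_decomposition_def unitary_def)
  then have "x \<bullet> (A *v x) = (\<Sum>j\<in>UNIV. d j * (cmod (axis i 1 $ j))\<^sup>2)"
    using inner_hermitian_fun[OF sd, of x "\<lambda>t. t"] A by (simp add: hermitian_fun_id hermitian_psd)
  also have "\<dots> = (\<Sum>j\<in>UNIV. if j = i then d j else 0)"
    by (intro sum.cong refl) (simp add: axis_def)
  also have "\<dots> = d i" by simp
  finally show ?thesis using A by (metis positive_semidefinite_iff)
qed

lemma psd_hermitian_fun:
  assumes A: "hermitian A" and f: "\<And>t. 0 \<le> f t"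
  shows "positive_semidefinite (hermitian_fun f A)"
proof -
  obtain U d where sd: "spectral_decomposition A U d" using spectral_theorem[OF A] by blast
  show ?thesis
    by (auto simp: positive_semidefinite_iff hermitian_hermitian_fun[OF A] inner_hermitian_fun[OF sd]
        intro!: sum_nonneg mult_nonneg_nonneg f)
qed

lemma psd_square:
  assumes h: "hermitian D" shows "positive_semidefinite (D ** D)"
  using psd_hermitian_fun[OF h, of "\<lambda>t. t * t"] hermitian_fun_id_mult[OF h, of "\<lambda>t. t"]
  by (simp add: hermitian_fun_id[OF h])

lemma hermitian_fun_cong_psd:
  assumes A: "positive_semidefinite A" and fg: "\<And>t. 0 \<le> t \<Longrightarrow> f t = g t"
  shows "hermitian_fun f A = hermitian_fun g A"
proof -
  obtain U d where sd: "spectral_decomposition A U d"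
    using spectral_theorem[OF hermitian_psd[OF A]] by blast
  show ?thesis
    using spectrum_psd[OF A sd] by (simp add: hermitian_fun_eq[OF sd] fg)
qed

lemma mat_powr_psd:
  assumes "positive_semidefinite A" shows "positive_semidefinite (mat_powr A r)"
  unfolding mat_powr_def by (rule psd_hermitian_fun) (use assms hermitian_psd in auto)

lemma mat_powr_mult:
  assumes A: "positive_semidefinite A"
  shows "mat_powr A r ** mat_powr A s = mat_powr A (r + s)"
  by (simp add: mat_powr_def hermitian_fun_mult[OF hermitian_psd[OF A]] powr_add)

lemma mat_powr_one:
  assumes A: "positive_semidefinite A" shows "mat_powr A 1 = A"
proof -
  have "mat_powr A 1 = hermitian_fun (\<lambda>t. t) A"
    unfolding mat_powr_def by (intro hermitian_fun_cong_psd[OF A]) simp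
  with hermitian_fun_id[OF hermitian_psd[OF A]] show ?thesis by (rule trans[rotated])
qed

lemma mat_powr_powr:
  assumes A: "positive_semidefinite A"
  shows "mat_powr (mat_powr A r) s = mat_powr A (r * s)"
  by (simp add: mat_powr_def hermitian_fun_comp[OF hermitian_psd[OF A]] powr_powr)

lemma mat_abs_hermitian:
  assumes h: "hermitian D" shows "mat_abs D = hermitian_fun abs D"
proof -
  have "conj_transpose D ** D = D ** hermitian_fun (\<lambda>t. t) D"
    using h by (simp add: hermitian_def[of D] hermitian_fun_id[OF h])
  then have "conj_transpose D ** D = hermitian_fun (\<lambda>t. t * t) D"
    by (simp add: hermitian_fun_id_mult[OF h])
  moreover have "(t * t) powr (1 / 2) = \<bar>t\<bar>" for t :: real
    by (simp add: powr_half_sqrt)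
  ultimately show ?thesis
    by (simp add: mat_abs_def mat_powr_def hermitian_fun_comp[OF h])
qed

text \<open>The positive part of a Hermitian matrix in the sense of its spectrum; \<open>pos_part (- D)\<close> is the
  negative part of \<open>D\<close>.\<close>

definition pos_part :: "complex^'n^'n \<Rightarrow> complex^'n^'n"
  where "pos_part D = hermitian_fun (max 0) D"

lemma psd_pos_part: "hermitian D \<Longrightarrow> positive_semidefinite (pos_part D)"
  unfolding pos_part_def by (rule psd_hermitian_fun) auto

lemma pos_part_diff:
  assumes h: "hermitian D" shows "pos_part D - pos_part (- D) = D"
proof -
  have "pos_part D - pos_part (- D) = hermitian_fun (\<lambda>t. max 0 t - max 0 (- t)) D"
    by (simp add: pos_part_def hermitian_fun_uminus[OF h] hermitian_fun_diff[OF h])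
  also have "(\<lambda>t::real. max 0 t - max 0 (- t)) = (\<lambda>t. t)" by (auto simp: max_def)
  finally show ?thesis by (simp add: hermitian_fun_id[OF h])
qed

lemma pos_part_add:
  assumes h: "hermitian D" shows "pos_part D + pos_part (- D) = mat_abs D"
proof -
  have "pos_part D + pos_part (- D) = hermitian_fun (\<lambda>t. max 0 t + max 0 (- t)) D"
    by (simp add: pos_part_def hermitian_fun_uminus[OF h] hermitian_fun_add[OF h])
  also have "(\<lambda>t::real. max 0 t + max 0 (- t)) = abs" by (auto simp: max_def)
  finally show ?thesis by (simp add: mat_abs_hermitian[OF h])
qed

lemma square_eq_pos_part_squares:
  assumes h: "hermitian D"
  shows "D ** D = pos_part D ** pos_part D + pos_part (- D) ** pos_part (- D)"
proof -
  have "pos_part D ** pos_part D + pos_part (- D) ** pos_part (- D) =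
      hermitian_fun (\<lambda>t. max 0 t * max 0 t + max 0 (- t) * max 0 (- t)) D"
    by (simp add: pos_part_def hermitian_fun_uminus[OF h] hermitian_fun_mult[OF h] hermitian_fun_add[OF h])
  also have "(\<lambda>t::real. max 0 t * max 0 t + max 0 (- t) * max 0 (- t)) = (\<lambda>t. t * t)"
    by (auto simp: fun_eq_iff max_def)
  also have "hermitian_fun (\<lambda>t. t * t) D = D ** D"
    using hermitian_fun_id_mult[OF h, of "\<lambda>t. t"] by (simp add: hermitian_fun_id[OF h])
  finally show ?thesis ..
qed

section \<open>Traces of products of two functional calculi\<close>

text \<open>All traces of interest are real; working with their real parts keeps the inequalities in
  \<^typ>\<open>real\<close>.\<close>

abbreviation rtr :: "complex^'n^'n \<Rightarrow> real"
  where "rtr A \<equiv> Re (trace A)"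

lemma rtr_scaleR: "rtr (c *\<^sub>R A) = c * rtr A"
  by (simp add: trace_def sum_distrib_left)

lemma trace_abs_powr_split:
  assumes h: "hermitian D"
  shows "rtr (mat_powr (mat_abs D) p) = rtr (mat_powr (pos_part D) p) + rtr (mat_powr (pos_part (- D)) p)"
proof -
  have "mat_powr (pos_part D) p + mat_powr (pos_part (- D)) p =
      hermitian_fun (\<lambda>t. max 0 t powr p + max 0 (- t) powr p) D"
    by (simp add: mat_powr_def pos_part_def hermitian_fun_uminus[OF h] hermitian_fun_comp[OF h]
        hermitian_fun_add[OF h])
  also have "(\<lambda>t::real. max 0 t powr p + max 0 (- t) powr p) = (\<lambda>t. \<bar>t\<bar> powr p)"
    by (auto simp: fun_eq_iff max_def)
  also have "hermitian_fun (\<lambda>t. \<bar>t\<bar> powr p) D = mat_powr (mat_abs D) p"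
    by (simp add: mat_abs_hermitian[OF h] mat_powr_def hermitian_fun_comp[OF h])
  finally have "mat_powr (mat_abs D) p = mat_powr (pos_part D) p + mat_powr (pos_part (- D)) p" ..
  then show ?thesis by (simp add: trace_add)
qed

text \<open>In eigenbases of \<open>A\<close> and \<open>B\<close> the trace becomes a double sum over pairs of eigenvalues. The
  weights are the squared overlaps of eigenvectors: they are nonnegative and do not depend on \<open>f\<close>
  and \<open>g\<close>. This is what reduces trace inequalities for noncommuting matrices to inequalities between
  real numbers.\<close>

lemma trace_mult_hermitian_fun:
  assumes A: "spectral_decomposition A U a" and B: "spectral_decomposition B V b"
  shows "rtr (hermitian_fun f A ** hermitian_fun g B) =
    (\<Sum>i\<in>UNIV. \<Sum>j\<in>UNIV. (cmod ((conj_transpose U ** V) $ i $ j))\<^sup>2 * f (a i) * g (b j))"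
proof -
  define W where "W = conj_transpose U ** V"
  let ?F = "real_diag (\<lambda>i. f (a i))" and ?G = "real_diag (\<lambda>i. g (b i))"
  have "trace (hermitian_fun f A ** hermitian_fun g B) =
      trace (U ** (?F ** W ** ?G ** conj_transpose V))"
    by (simp add: hermitian_fun_eq[OF A] hermitian_fun_eq[OF B] W_def matrix_mul_assoc)
  also have "\<dots> = trace ((?F ** W ** ?G) ** (conj_transpose V ** U))"
    by (subst trace_mul_sym) (simp add: matrix_mul_assoc)
  also have "conj_transpose V ** U = conj_transpose W"
    by (simp add: W_def conj_transpose_mult)
  also have "trace ((?F ** W ** ?G) ** conj_transpose W) =
      (\<Sum>i\<in>UNIV. \<Sum>j\<in>UNIV. (?F ** W ** ?G) $ i $ j * cnj (W $ i $ j))"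
    by (simp add: trace_def matrix_matrix_mult_def[of _ "conj_transpose W"] conj_transpose_nth)
  finally have "rtr (hermitian_fun f A ** hermitian_fun g B) =
      (\<Sum>i\<in>UNIV. \<Sum>j\<in>UNIV. Re ((?F ** W ** ?G) $ i $ j * cnj (W $ i $ j)))"
    by simp
  also have "\<dots> = (\<Sum>i\<in>UNIV. \<Sum>j\<in>UNIV. (cmod (W $ i $ j))\<^sup>2 * f (a i) * g (b j))"
    unfolding cmod_power2
    by (intro sum.cong refl)
      (simp add: real_diag_mult_right real_diag_mult_left power2_eq_square algebra_simps)
  finally show ?thesis by (simp add: W_def)
qed

lemma joint_spectral_weights:
  fixes A B :: "complex^'n^'n"
  assumes A: "hermitian A" and B: "hermitian B"
  obtains w :: "'n \<Rightarrow> 'n \<Rightarrow> real" and a b :: "'n \<Rightarrow> real" where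
    "\<And>i j. 0 \<le> w i j"
    "\<And>f g. rtr (hermitian_fun f A ** hermitian_fun g B) =
      (\<Sum>i\<in>UNIV. \<Sum>j\<in>UNIV. w i j * f (a i) * g (b j))"
    "\<And>i. positive_semidefinite A \<Longrightarrow> 0 \<le> a i"
    "\<And>j. positive_semidefinite B \<Longrightarrow> 0 \<le> b j"
proof -
  obtain U a where sA: "spectral_decomposition A U a" using spectral_theorem[OF A] by blast
  obtain V b where sB: "spectral_decomposition B V b" using spectral_theorem[OF B] by blast
  show thesis
    by (rule that[of "\<lambda>i j. (cmod ((conj_transpose U ** V) $ i $ j))\<^sup>2" a b])
      (auto simp: trace_mult_hermitian_fun[OF sA sB] spectrum_psd[OF _ sA] spectrum_psd[OF _ sB])
qed

text \<open>Klein's principle: an inequality \<open>\<Sum> c * f s * g t \<ge> 0\<close> for all pairs of reals passes to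
  the traces of \<open>f A ** g B\<close>, although \<open>A\<close> and \<open>B\<close> need not commute. The terms are collected in a
  list so that concrete instances unfold by simplification. The reals \<open>s\<close> and \<open>t\<close> may be taken
  nonnegative when the corresponding matrix is positive semidefinite.\<close>

lemma klein_inequality:
  fixes A B :: "complex^'n^'n"
  assumes A: "hermitian A" and B: "hermitian B"
    and nonneg: "\<And>s t. (positive_semidefinite A \<Longrightarrow> 0 \<le> s) \<Longrightarrow> (positive_semidefinite B \<Longrightarrow> 0 \<le> t) \<Longrightarrow>
      0 \<le> (\<Sum>(c, f, g)\<leftarrow>fs. c * (f s * g t))"
  shows "0 \<le> (\<Sum>(c, f, g)\<leftarrow>fs. c * rtr (hermitian_fun f A ** hermitian_fun g B))"
proof -
  from joint_spectral_weights[OF A B]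
  obtain w :: "'n \<Rightarrow> 'n \<Rightarrow> real" and a b where w: "\<And>i j. 0 \<le> w i j"
    and tr: "\<And>f g. rtr (hermitian_fun f A ** hermitian_fun g B) =
      (\<Sum>i\<in>UNIV. \<Sum>j\<in>UNIV. w i j * f (a i) * g (b j))"
    and a: "\<And>i. positive_semidefinite A \<Longrightarrow> 0 \<le> a i"
    and b: "\<And>j. positive_semidefinite B \<Longrightarrow> 0 \<le> b j" by blast
  have "0 \<le> (\<Sum>i\<in>UNIV. \<Sum>j\<in>UNIV. w i j * (\<Sum>(c, f, g)\<leftarrow>fs. c * (f (a i) * g (b j))))"
    by (intro sum_nonneg mult_nonneg_nonneg w nonneg a b)
  also have "\<dots> = (\<Sum>(c, f, g)\<leftarrow>fs. c * rtr (hermitian_fun f A ** hermitian_fun g B))"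
    unfolding tr
    by (induction fs) (auto simp: sum.distrib distrib_left sum_distrib_left mult_ac)
  finally show ?thesis .
qed

lemma trace_mult_psd_nonneg:
  fixes A B :: "complex^'n^'n"
  assumes A: "positive_semidefinite A" and B: "positive_semidefinite B"
  shows "0 \<le> rtr (A ** B)"
proof -
  from joint_spectral_weights[OF hermitian_psd[OF A] hermitian_psd[OF B]]
  obtain w :: "'n \<Rightarrow> 'n \<Rightarrow> real" and a b where w: "\<And>i j. 0 \<le> w i j"
    and tr: "\<And>f g. rtr (hermitian_fun f A ** hermitian_fun g B) =
      (\<Sum>i\<in>UNIV. \<Sum>j\<in>UNIV. w i j * f (a i) * g (b j))"
    and pos: "\<And>i. positive_semidefinite A \<Longrightarrow> 0 \<le> a i"
      "\<And>j. positive_semidefinite B \<Longrightarrow> 0 \<le> b j" by blast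
  have "rtr (A ** B) = rtr (hermitian_fun (\<lambda>t. t) A ** hermitian_fun (\<lambda>t. t) B)"
    by (simp only: hermitian_fun_id hermitian_psd A B)
  also have "0 \<le> \<dots>"
    unfolding tr by (intro sum_nonneg mult_nonneg_nonneg w pos A B)
  finally show ?thesis .
qed

lemma trace_mult_mono_left:
  assumes "positive_semidefinite (B - A)" "positive_semidefinite C"
  shows "rtr (A ** C) \<le> rtr (B ** C)"
  using trace_mult_psd_nonneg[OF assms] unfolding matrix_mult_diff_left trace_sub by simp

lemma trace_mult_mono_right:
  assumes "positive_semidefinite (B - A)" "positive_semidefinite C"
  shows "rtr (C ** A) \<le> rtr (C ** B)"
  using trace_mult_mono_left[OF assms] unfolding trace_mul_sym[of C] .

section \<open>Operator monotonicity of fractional powers\<close>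

abbreviation resolvent :: "real \<Rightarrow> complex^'n^'n \<Rightarrow> complex^'n^'n"
  where "resolvent l \<equiv> hermitian_fun (\<lambda>t. 1 / (t + l))"

lemma hermitian_fun_resolvent:
  fixes A :: "complex^'n^'n"
  assumes A: "positive_semidefinite A" and l: "0 < l"
  shows "(A + real_diag (\<lambda>_. l)) ** resolvent l A = mat 1"
proof -
  have h: "hermitian A" using A by (rule hermitian_psd)
  have "A + real_diag (\<lambda>_. l) = hermitian_fun (\<lambda>t. t) A + hermitian_fun (\<lambda>_. l) A"
    by (simp only: hermitian_fun_id[OF h] hermitian_fun_const[OF h])
  then have "(A + real_diag (\<lambda>_. l)) ** resolvent l A =
      hermitian_fun (\<lambda>t. (t + l) * (1 / (t + l))) A"
    by (simp only: hermitian_fun_add[OF h] hermitian_fun_mult[OF h])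
  also have "\<dots> = hermitian_fun (\<lambda>t. 1) A"
    using l by (intro hermitian_fun_cong_psd[OF A]) auto
  finally show ?thesis by (simp only: hermitian_fun_one[OF h])
qed

text \<open>Put \<open>x = (A + l)\<inverse> v\<close> and \<open>y = (B + l)\<inverse> v\<close>. Completing the square gives
  \<open>x \<bullet> v \<ge> 2 (y \<bullet> v) - y \<bullet> (A + l) y\<close>, and the right-hand side only gets smaller, namely equal
  to \<open>y \<bullet> v\<close>, when \<open>A\<close> is replaced by the larger \<open>B\<close>.\<close>

lemma resolvent_antimono:
  fixes A B :: "complex^'n^'n"
  assumes A: "positive_semidefinite A" and AB: "positive_semidefinite (B - A)" and l: "0 < l"
  shows "positive_semidefinite
    (resolvent l A - resolvent l B)"
proof -
  have B: "positive_semidefinite B" using psd_add[OF A AB] by simp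
  define RA where "RA = resolvent l A"
  define RB where "RB = resolvent l B"
  define SA where "SA = A + real_diag (\<lambda>_. l)"
  define SB where "SB = B + real_diag (\<lambda>_. l)"
  have L: "positive_semidefinite (real_diag (\<lambda>_. l) :: complex^'n^'n)"
    using psd_hermitian_fun[of A "\<lambda>_. l"] hermitian_fun_const[of A l] hermitian_psd[OF A] l by simp
  have SA: "positive_semidefinite SA" unfolding SA_def by (intro psd_add A L)
  have "v \<bullet> ((RA - RB) *v v) \<ge> 0" for v
  proof -
    define x where "x = RA *v v"
    define y where "y = RB *v v"
    have x: "SA *v x = v" and y: "SB *v y = v"
      using hermitian_fun_resolvent[OF A l] hermitian_fun_resolvent[OF B l]
      by (simp_all add: x_def y_def SA_def SB_def RA_def RB_def matrix_vector_mul_assoc)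
    have "SB - SA = B - A" by (simp add: SA_def SB_def)
    with AB have "0 \<le> y \<bullet> ((SB - SA) *v y)" by (simp add: positive_semidefinite_iff)
    then have "y \<bullet> (SA *v y) \<le> y \<bullet> v"
      by (simp add: matrix_vector_mult_diff_rdistrib inner_diff_right y)
    moreover have "0 \<le> (x - y) \<bullet> (SA *v (x - y))"
      using SA by (simp add: positive_semidefinite_iff)
    moreover have "(x - y) \<bullet> (SA *v (x - y)) = x \<bullet> v - y \<bullet> v - x \<bullet> (SA *v y) + y \<bullet> (SA *v y)"
      by (simp add: matrix_vector_mult_diff_distrib x inner_diff_left inner_diff_right)
    moreover have "x \<bullet> (SA *v y) = y \<bullet> v"
      using inner_hermitian[OF hermitian_psd[OF SA], of x y] x by (simp add: inner_commute)
    ultimately have "y \<bullet> v \<le> x \<bullet> v" by linarith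
    then show ?thesis
      by (simp add: matrix_vector_mult_diff_rdistrib inner_diff_right inner_commute x_def y_def)
  qed
  then show ?thesis
    unfolding RA_def[symmetric] RB_def[symmetric] positive_semidefinite_iff
    by (simp add: RA_def RB_def hermitian_diff hermitian_hermitian_fun hermitian_psd A B)
qed

text \<open>The integrand of the Stieltjes representation
  \<open>C * t powr r = \<integral> l powr (r - 1) * (t / (t + l)) dl\<close> over \<open>l > 0\<close>, for \<open>0 < r < 1\<close>, extended by
  zero to all real \<open>l\<close>. For fixed \<open>l\<close> it is an affine function of \<open>1 / (t + l)\<close>, so that powers
  inherit properties of resolvents.\<close>

definition stieltjes :: "real \<Rightarrow> real \<Rightarrow> real \<Rightarrow> real"
  where "stieltjes r l t = (if 0 < l then l powr (r - 1) * (t / (t + l)) else 0)"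

lemma has_bochner_integral_of_has_integral:
  fixes f :: "real \<Rightarrow> real"
  assumes "f \<in> borel_measurable borel" "\<And>x. 0 \<le> f x" "(f has_integral I) UNIV"
  shows "has_bochner_integral lborel f I"
  using nn_integral_has_integral_lborel[OF assms] has_integral_nonneg[OF assms(3)] assms
  by (intro has_bochner_integral_nn_integral) auto

text \<open>For \<open>t = 1\<close> the integrand is at most \<open>l powr (r - 1)\<close> near \<open>0\<close> and at most \<open>l powr (r - 2)\<close> near
  infinity, both integrable; the substitution \<open>l \<mapsto> l / t\<close> reduces every \<open>t > 0\<close> to this case. The
  constant is \<open>\<pi> / sin (\<pi> r)\<close>; only its sign enters below.\<close>

lemma stieltjes_integral:
  assumes r: "0 < r" "r < 1"
  shows "\<exists>C>0. \<forall>t\<ge>0. has_bochner_integral lborel (\<lambda>l. stieltjes r l t) (C * t powr r)"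
proof -
  define g where "g = (\<lambda>l. stieltjes r l 1)"
  define h0 where "h0 = (\<lambda>l. if l \<in> {0..1} then l powr (r - 1) else 0)"
  define h1 where "h1 = (\<lambda>l. if l \<in> {1..} then l powr (r - 2) else 0)"
  have h0: "has_bochner_integral lborel h0 (1 / r)"
    unfolding h0_def
  proof (rule has_bochner_integral_of_has_integral)
    show "((\<lambda>l. if l \<in> {0..1} then l powr (r - 1) else 0) has_integral 1 / r) UNIV"
      unfolding has_integral_restrict_UNIV using has_integral_powr_from_0[of "r - 1" 1] r by simp
  qed auto
  have "has_bochner_integral lborel h1 (1 / (1 - r))"
    unfolding h1_def
  proof (rule has_bochner_integral_of_has_integral)
    have "1 / (1 - r) = - (1 powr (r - 2 + 1)) / (r - 2 + 1)"
      using r by (simp add: divide_simps)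
    then show "((\<lambda>l. if l \<in> {1..} then l powr (r - 2) else 0) has_integral 1 / (1 - r)) UNIV"
      unfolding has_integral_restrict_UNIV using has_integral_powr_to_inf[of "r - 2" 1] r by simp
  qed auto
  with h0 have h: "integrable lborel (\<lambda>l. h0 l + h1 l)"
    by (auto simp: has_bochner_integral_iff)
  have g_meas: "g \<in> borel_measurable lborel"
    unfolding g_def stieltjes_def by measurable
  have g_le: "norm (g l) \<le> norm (h0 l + h1 l)" for l
  proof -
    consider "l \<le> 0" | "0 < l" "l \<le> 1" | "1 < l" by linarith
    then have "0 \<le> g l \<and> g l \<le> h0 l + h1 l"
    proof cases
      case 1
      then show ?thesis by (simp add: g_def stieltjes_def h0_def h1_def)
    next
      case 2
      then have "l powr (r - 1) * (1 / (1 + l)) \<le> l powr (r - 1) * 1"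
        by (intro mult_left_mono) auto
      with 2 show ?thesis by (simp add: g_def stieltjes_def h0_def h1_def)
    next
      case 3
      then have "l powr (r - 1) * (1 / (1 + l)) \<le> l powr (r - 1) * (1 / l)"
        by (intro mult_left_mono divide_left_mono) auto
      also have "l powr (r - 1) * (1 / l) = l powr (r - 2)"
        using 3 powr_add[of l "r - 2" 1] by simp
      finally show ?thesis using 3 by (simp add: g_def stieltjes_def h0_def h1_def)
    qed
    then show ?thesis by simp
  qed
  have g: "integrable lborel g"
    by (rule Bochner_Integration.integrable_bound[OF h g_meas]) (use g_le in auto)
  define C where "C = integral\<^sup>L lborel g"
  have "integral\<^sup>L lborel (\<lambda>l. 1 / 2 * h0 l) \<le> C"
    unfolding C_def
  proof (rule integral_mono)
    fix l :: real
    show "1 / 2 * h0 l \<le> g l"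
    proof (cases "0 < l \<and> l \<le> 1")
      case True
      then have "1 / 2 \<le> 1 / (1 + l)" by (intro divide_left_mono) auto
      from mult_left_mono[OF this, of "l powr (r - 1)"] True show ?thesis
        by (simp add: g_def stieltjes_def h0_def)
    next
      case False
      then have "h0 l = 0" by (cases "l = 0") (auto simp: h0_def)
      moreover have "0 \<le> g l" by (simp add: g_def stieltjes_def)
      ultimately show ?thesis by simp
    qed
  qed (use g h0 in \<open>auto simp: has_bochner_integral_iff\<close>)
  moreover have "integral\<^sup>L lborel (\<lambda>l. 1 / 2 * h0 l) = 1 / 2 * (1 / r)"
    using h0 by (simp add: has_bochner_integral_iff)
  moreover have "0 < 1 / 2 * (1 / r)" using r by simp
  ultimately have "C > 0" by linarith
  moreover have "has_bochner_integral lborel (\<lambda>l. stieltjes r l t) (C * t powr r)" if "0 \<le> t" for t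
  proof (cases "t = 0")
    case True
    then have "stieltjes r l t = 0" for l by (simp add: stieltjes_def)
    with True show ?thesis by (simp add: has_bochner_integral_zero)
  next
    case False
    with that have t: "t > 0" by simp
    have "has_bochner_integral lborel g C" using g by (simp add: has_bochner_integral_iff C_def)
    then have "has_bochner_integral lborel (\<lambda>l. g (0 + (1 / t) * l)) (C /\<^sub>R \<bar>1 / t\<bar>)"
      using lborel_has_bochner_integral_real_affine_iff[of "1 / t" g C 0] t by simp
    then have int: "has_bochner_integral lborel (\<lambda>l. t powr (r - 1) * g (0 + (1 / t) * l))
        (t powr (r - 1) * (C /\<^sub>R \<bar>1 / t\<bar>))"
      by (rule has_bochner_integral_mult_right)
    have val: "t powr (r - 1) * g (0 + (1 / t) * l) = stieltjes r l t" for l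
    proof (cases "0 < l")
      case True
      then have "1 / (1 + l / t) = t / (t + l)" using t by (simp add: divide_simps)
      moreover have "t powr (r - 1) * (l / t) powr (r - 1) = l powr (r - 1)"
        using t True by (simp add: powr_divide)
      moreover have "0 < l / t" using t True by simp
      ultimately show ?thesis
        using True by (simp add: g_def stieltjes_def mult.assoc[symmetric] del: times_divide_eq_right)
    next
      case False
      with t have "\<not> 0 < l / t" by (simp add: zero_less_divide_iff)
      with False show ?thesis by (simp add: g_def stieltjes_def)
    qed
    have scale: "t powr (r - 1) * (C /\<^sub>R \<bar>1 / t\<bar>) = C * t powr r"
    proof -
      have "t powr r = t powr (r - 1) * t" using t powr_add[of t "r - 1" 1] by simp
      then show ?thesis using t by simp
    qed
    show ?thesis using int unfolding val scale .
  qed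
  ultimately show ?thesis by blast
qed

text \<open>A quadratic form of \<open>f A\<close> is a finite linear combination of values of \<open>f\<close> on the spectrum, so
  integral representations of scalar functions carry over without matrix-valued integration.\<close>

lemma has_bochner_integral_inner_hermitian_fun:
  assumes A: "positive_semidefinite A"
    and F: "\<And>t. 0 \<le> t \<Longrightarrow> has_bochner_integral M (\<lambda>l. F l t) (G t)"
  shows "has_bochner_integral M (\<lambda>l. x \<bullet> (hermitian_fun (F l) A *v x)) (x \<bullet> (hermitian_fun G A *v x))"
proof -
  obtain U d where sd: "spectral_decomposition A U d"
    using spectral_theorem[OF hermitian_psd[OF A]] by blast
  show ?thesis
    unfolding inner_hermitian_fun[OF sd]
    by (rule has_bochner_integral_sum, rule has_bochner_integral_mult_left, rule F,
        rule spectrum_psd[OF A sd])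
qed

lemma has_bochner_integral_trace_hermitian_fun:
  fixes H A :: "complex^'n^'n"
  assumes H: "hermitian H" and A: "positive_semidefinite A"
    and F: "\<And>t. 0 \<le> t \<Longrightarrow> has_bochner_integral M (\<lambda>l. F l t) (G t)"
  shows "has_bochner_integral M (\<lambda>l. rtr (H ** hermitian_fun (F l) A)) (rtr (H ** hermitian_fun G A))"
proof -
  from joint_spectral_weights[OF H hermitian_psd[OF A]]
  obtain w :: "'n \<Rightarrow> 'n \<Rightarrow> real" and a b where "\<And>i j. 0 \<le> w i j"
    and tr: "\<And>f g. rtr (hermitian_fun f H ** hermitian_fun g A) =
      (\<Sum>i\<in>UNIV. \<Sum>j\<in>UNIV. w i j * f (a i) * g (b j))"
    and "\<And>i. positive_semidefinite H \<Longrightarrow> 0 \<le> a i"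
    and pos: "\<And>j. positive_semidefinite A \<Longrightarrow> 0 \<le> b j" by blast
  have "has_bochner_integral M (\<lambda>l. rtr (hermitian_fun (\<lambda>t. t) H ** hermitian_fun (F l) A))
      (rtr (hermitian_fun (\<lambda>t. t) H ** hermitian_fun G A))"
    unfolding tr
    by (intro has_bochner_integral_sum has_bochner_integral_mult_right F pos A)
  then show ?thesis unfolding hermitian_fun_id[OF H] .
qed

lemma has_bochner_integral_nonneg:
  fixes f :: "'a \<Rightarrow> real"
  assumes "has_bochner_integral M f x" "\<And>l. 0 \<le> f l"
  shows "0 \<le> x"
  using has_bochner_integral_integral_eq[OF assms(1)] Bochner_Integration.integral_nonneg[of M f] assms(2)
  by simp

text \<open>The Loewner--Heinz theorem. The function \<open>t / (t + l) = 1 - l / (t + l)\<close> is operator monotone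
  because the resolvent is antitone, and \<open>t powr r\<close> is a positive mixture of these functions.\<close>

theorem loewner_heinz:
  fixes A B :: "complex^'n^'n"
  assumes A: "positive_semidefinite A" and AB: "positive_semidefinite (B - A)"
    and r: "0 < r" "r < 1"
  shows "positive_semidefinite (hermitian_fun (\<lambda>t. t powr r) B - hermitian_fun (\<lambda>t. t powr r) A)"
proof -
  have B: "positive_semidefinite B" using psd_add[OF A AB] by simp
  note hA = hermitian_psd[OF A] and hB = hermitian_psd[OF B]
  obtain C where C: "C > 0"
    and int: "\<And>t. 0 \<le> t \<Longrightarrow> has_bochner_integral lborel (\<lambda>l. stieltjes r l t) (C * t powr r)"
    using stieltjes_integral[OF r] by blast
  have mono: "positive_semidefinite (hermitian_fun (stieltjes r l) B - hermitian_fun (stieltjes r l) A)"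
    for l
  proof (cases "0 < l")
    case True
    have eq: "hermitian_fun (stieltjes r l) X =
        l powr (r - 1) *\<^sub>R (mat 1 - l *\<^sub>R resolvent l X)"
      if X: "positive_semidefinite X" for X :: "complex^'n^'n"
    proof -
      note h = hermitian_psd[OF X]
      have "t / (t + l) = 1 - l * (1 / (t + l))" if "0 \<le> t" for t
        using True that by (simp add: field_simps)
      then have "hermitian_fun (stieltjes r l) X =
          hermitian_fun (\<lambda>t. l powr (r - 1) * (1 - l * (1 / (t + l)))) X"
        using True by (intro hermitian_fun_cong_psd[OF X]) (simp add: stieltjes_def)
      then show ?thesis
        by (simp only: hermitian_fun_scale[OF h] hermitian_fun_diff[OF h, symmetric]
            hermitian_fun_one[OF h])
    qed
    have "positive_semidefinite (l powr (r - 1) *\<^sub>R l *\<^sub>R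
        (resolvent l A - resolvent l B))"
      using True by (intro psd_scaleR resolvent_antimono[OF A AB]) auto
    then show ?thesis by (simp add: eq[OF A] eq[OF B] scaleR_diff_right)
  next
    case False
    then have "stieltjes r l = (\<lambda>_. 0)" by (simp add: stieltjes_def fun_eq_iff)
    then show ?thesis
      by (simp add: hermitian_fun_const[OF hA] hermitian_fun_const[OF hB] psd_zero)
  qed
  have "0 \<le> v \<bullet> ((hermitian_fun (\<lambda>t. t powr r) B - hermitian_fun (\<lambda>t. t powr r) A) *v v)" for v
  proof -
    have "has_bochner_integral lborel
        (\<lambda>l. v \<bullet> (hermitian_fun (stieltjes r l) B *v v) - v \<bullet> (hermitian_fun (stieltjes r l) A *v v))
        (v \<bullet> (hermitian_fun (\<lambda>t. C * t powr r) B *v v) - v \<bullet> (hermitian_fun (\<lambda>t. C * t powr r) A *v v))"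
      by (intro has_bochner_integral_diff has_bochner_integral_inner_hermitian_fun A B int)
    then have "0 \<le> v \<bullet> (hermitian_fun (\<lambda>t. C * t powr r) B *v v) - v \<bullet> (hermitian_fun (\<lambda>t. C * t powr r) A *v v)"
      by (rule has_bochner_integral_nonneg)
        (use mono in \<open>simp add: positive_semidefinite_iff matrix_vector_mult_diff_rdistrib inner_diff_right\<close>)
    also have "\<dots> = C * (v \<bullet> ((hermitian_fun (\<lambda>t. t powr r) B - hermitian_fun (\<lambda>t. t powr r) A) *v v))"
      by (simp add: hermitian_fun_scale[OF hA] hermitian_fun_scale[OF hB] matrix_vector_mult_diff_rdistrib
          inner_diff_right right_diff_distrib matrix_vector_scaleR_left)
    finally show ?thesis using C by (simp add: zero_le_mult_iff)
  qed
  then show ?thesis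
    by (simp add: positive_semidefinite_iff hermitian_diff hermitian_hermitian_fun hA hB)
qed

section \<open>The upper bound by the trace norm\<close>

text \<open>Audenaert's strengthening of the Powers--Stormer inequality, with Ozawa's proof. The matrix
  \<open>E = Y + pos_part (X - Y)\<close> dominates both \<open>X\<close> and \<open>Y\<close>. The left-hand
  side is the trace of \<open>(X\<^sup>s - Y\<^sup>s) X\<^sup>1\<^sup>-\<^sup>s\<close>. By the Loewner--Heinz theorem it does not decrease when \<open>X\<close> is
  replaced by \<open>E\<close>, first in \<open>X\<^sup>s\<close> and then, since \<open>E\<^sup>s - Y\<^sup>s\<close> is positive semidefinite, in \<open>X\<^sup>1\<^sup>-\<^sup>s\<close>. The result
  \<open>Tr E - Tr Y\<^sup>s E\<^sup>1\<^sup>-\<^sup>s\<close> is at most \<open>Tr E - Tr Y\<close> because \<open>E\<^sup>1\<^sup>-\<^sup>s\<close> dominates \<open>Y\<^sup>1\<^sup>-\<^sup>s\<close>.\<close>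

lemma trace_minus_powr_mult_le_pos_part:
  fixes X Y :: "complex^'n^'n"
  assumes X: "positive_semidefinite X" and Y: "positive_semidefinite Y" and s: "0 < s" "s < 1"
  shows "rtr X - rtr (mat_powr Y s ** mat_powr X (1 - s)) \<le> rtr (pos_part (X - Y))"
proof -
  have h: "hermitian (X - Y)" by (intro hermitian_diff hermitian_psd X Y)
  define E where "E = Y + pos_part (X - Y)"
  have E: "positive_semidefinite E" unfolding E_def by (intro psd_add Y psd_pos_part h)
  have YE: "positive_semidefinite (E - Y)" by (simp add: E_def psd_pos_part h)
  have "E - X = pos_part (- (X - Y))"
    using pos_part_diff[OF h] by (simp add: E_def algebra_simps)
  then have XE: "positive_semidefinite (E - X)"
    using psd_pos_part[of "- (X - Y)"] hermitian_diff[OF hermitian_psd[OF Y] hermitian_psd[OF X]] by simp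
  have mono: "positive_semidefinite (mat_powr E r - mat_powr Z r)"
    if "Z = X \<or> Z = Y" "r = s \<or> r = 1 - s" for Z r
    unfolding mat_powr_def using that s X Y XE YE by (intro loewner_heinz) auto
  have split: "rtr (mat_powr Z s ** mat_powr Z (1 - s)) = rtr Z" if "positive_semidefinite Z" for Z :: "complex^'n^'n"
    using that by (simp add: mat_powr_mult mat_powr_one)
  have "rtr X - rtr (mat_powr Y s ** mat_powr X (1 - s)) =
      rtr ((mat_powr X s - mat_powr Y s) ** mat_powr X (1 - s))"
    using split[OF X] by (simp add: matrix_mult_diff_left trace_sub)
  also have "\<dots> \<le> rtr ((mat_powr E s - mat_powr Y s) ** mat_powr X (1 - s))"
    using mono[of X s] by (intro trace_mult_mono_left mat_powr_psd X) simp
  also have "\<dots> \<le> rtr ((mat_powr E s - mat_powr Y s) ** mat_powr E (1 - s))"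
    by (intro trace_mult_mono_right mono) auto
  also have "\<dots> = rtr E - rtr (mat_powr Y s ** mat_powr E (1 - s))"
    using split[OF E] by (simp add: matrix_mult_diff_left trace_sub)
  also have "\<dots> \<le> rtr E - rtr (mat_powr Y s ** mat_powr Y (1 - s))"
    using trace_mult_mono_right[OF mono[of Y "1 - s"] mat_powr_psd[OF Y, of s]] by simp
  also have "\<dots> = rtr (pos_part (X - Y))"
    using split[OF Y] by (simp add: E_def trace_add)
  finally show ?thesis .
qed

text \<open>For \<open>X = A\<^sup>p\<close>, \<open>Y = B\<^sup>p\<close> and \<open>s = 1/p\<close>, expanding the product on the left gives
  \<open>(Tr X - Tr Y\<^sup>s X\<^sup>1\<^sup>-\<^sup>s) + (Tr Y - Tr X\<^sup>s Y\<^sup>1\<^sup>-\<^sup>s)\<close>. The two brackets are bounded by the traces of the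
  positive and of the negative part of \<open>X - Y\<close>.\<close>

lemma trace_abs_powr_diff_ge:
  fixes A B :: "complex^'n^'n"
  assumes p: "1 < p" and A: "positive_semidefinite A" and B: "positive_semidefinite B"
  shows "rtr ((A - B) ** (mat_powr A (p - 1) - mat_powr B (p - 1))) \<le>
    rtr (mat_abs (mat_powr A p - mat_powr B p))"
proof -
  define X where "X = mat_powr A p"
  define Y where "Y = mat_powr B p"
  define s where "s = 1 / p"
  have X: "positive_semidefinite X" and Y: "positive_semidefinite Y"
    by (simp_all add: X_def Y_def mat_powr_psd A B)
  have s: "0 < s" "s < 1" using p by (simp_all add: s_def)
  have root: "mat_powr (mat_powr C p) s = C" "mat_powr (mat_powr C p) (1 - s) = mat_powr C (p - 1)"
    "C ** mat_powr C (p - 1) = mat_powr C p"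
    if C: "positive_semidefinite C" for C :: "complex^'n^'n"
  proof -
    have "p * s = 1" "p * (1 - s) = p - 1" using p by (simp_all add: s_def field_simps)
    then show "mat_powr (mat_powr C p) s = C" "mat_powr (mat_powr C p) (1 - s) = mat_powr C (p - 1)"
      by (simp_all add: mat_powr_powr[OF C] mat_powr_one[OF C])
    show "C ** mat_powr C (p - 1) = mat_powr C p"
      using mat_powr_mult[OF C, of 1 "p - 1"] by (simp add: mat_powr_one[OF C])
  qed
  have "rtr ((A - B) ** (mat_powr A (p - 1) - mat_powr B (p - 1))) =
      (rtr X - rtr (B ** mat_powr A (p - 1))) + (rtr Y - rtr (A ** mat_powr B (p - 1)))"
    by (simp add: matrix_mult_diff_left matrix_mult_diff_right trace_sub root A B X_def Y_def)
  also have "\<dots> \<le> rtr (pos_part (X - Y)) + rtr (pos_part (Y - X))"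
    using trace_minus_powr_mult_le_pos_part[OF X Y s] trace_minus_powr_mult_le_pos_part[OF Y X s]
    by (simp add: X_def Y_def root A B)
  also have "\<dots> = rtr (mat_abs (X - Y))"
  proof -
    have "mat_abs (X - Y) = pos_part (X - Y) + pos_part (Y - X)"
      using pos_part_add[of "X - Y"] hermitian_diff[OF hermitian_psd[OF X] hermitian_psd[OF Y]] by simp
    then show ?thesis by (simp add: trace_add)
  qed
  finally show ?thesis by (simp add: X_def Y_def)
qed

section \<open>The lower bound for exponents at least three\<close>

text \<open>After cancellation of common terms this is Klein's principle applied to
  \<open>s t (s - t) (s\<^sup>r\<^sup>-\<^sup>1 - t\<^sup>r\<^sup>-\<^sup>1) \<ge> 0\<close>, which is where \<open>r \<ge> 1\<close> enters.\<close>

lemma trace_diff_mult_powr_diff_ge_square: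
  fixes A B :: "complex^'n^'n"
  assumes r: "1 \<le> r" and A: "positive_semidefinite A" and B: "positive_semidefinite B"
  shows "rtr ((A - B) ** (A - B) ** (mat_powr A r + mat_powr B r)) \<le>
    rtr ((A - B) ** (mat_powr A (r + 1) - mat_powr B (r + 1)))"
proof -
  note hA = hermitian_psd[OF A] and hB = hermitian_psd[OF B]
  have pw: "t powr (r + 1) = t powr (r - 1) * (t * t)" "t powr r = t powr (r - 1) * t" if "0 \<le> t" for t :: real
    using that powr_add[of t "r - 1" 2] powr_add[of t "r - 1" 1] r
    by (auto simp: power2_eq_square powr_numeral add.commute[of r 1])
  have scalar: "0 \<le> s powr (r + 1) * t + s * t powr (r + 1) - s powr r * (t * t) - s * s * t powr r"
    if "0 \<le> s" "0 \<le> t" for s t :: real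
  proof -
    have "0 \<le> (s - t) * (s powr (r - 1) - t powr (r - 1))"
      using that r by (cases "s \<le> t") (auto simp: zero_le_mult_iff intro!: powr_mono2)
    then have "0 \<le> s * t * ((s - t) * (s powr (r - 1) - t powr (r - 1)))"
      using that by simp
    then show ?thesis unfolding pw[OF that(1)] pw[OF that(2)] by (simp add: algebra_simps)
  qed
  have "0 \<le> (\<Sum>(c, f, g)\<leftarrow>[(1, \<lambda>s. s powr (r + 1), \<lambda>t. t), (1, \<lambda>s. s, \<lambda>t. t powr (r + 1)),
        (- 1, \<lambda>s. s powr r, \<lambda>t. t * t), (- 1, \<lambda>s. s * s, \<lambda>t. t powr r)].
      c * rtr (hermitian_fun f A ** hermitian_fun g B))"
    by (rule klein_inequality[OF hA hB]) (use scalar A B in force)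
  then have klein: "rtr (mat_powr A r ** (B ** B)) + rtr (A ** A ** mat_powr B r) \<le>
      rtr (mat_powr A (r + 1) ** B) + rtr (A ** mat_powr B (r + 1))"
    using hermitian_fun_id_mult[OF hA, of "\<lambda>t. t"] hermitian_fun_id_mult[OF hB, of "\<lambda>t. t"]
    by (simp add: mat_powr_def hermitian_fun_id[OF hA] hermitian_fun_id[OF hB])
  have sq: "C ** mat_powr C r = mat_powr C (r + 1)" "mat_powr C r ** C = mat_powr C (r + 1)"
    if C: "positive_semidefinite C" for C :: "complex^'n^'n"
    using mat_powr_mult[OF C, of 1 r] mat_powr_mult[OF C, of r 1]
    by (simp_all add: mat_powr_one[OF C] add.commute)
  have "rtr ((A - B) ** (A - B) ** (mat_powr A r + mat_powr B r)) =
      rtr (A ** (A ** mat_powr A r)) - rtr ((A ** B) ** mat_powr A r) - rtr (B ** (A ** mat_powr A r))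
        + rtr ((B ** B) ** mat_powr A r)
      + rtr (A ** A ** mat_powr B r) - rtr (A ** (B ** mat_powr B r)) - rtr ((B ** A) ** mat_powr B r)
        + rtr (B ** (B ** mat_powr B r))"
    by (simp add: matrix_mult_diff_left matrix_mult_diff_right matrix_add_ldistrib trace_add trace_sub
        matrix_mul_assoc)
  also have "rtr ((A ** B) ** mat_powr A r) = rtr (mat_powr A (r + 1) ** B)"
    by (subst trace_mul_sym) (simp add: matrix_mul_assoc sq A)
  also have "rtr (B ** (A ** mat_powr A r)) = rtr (mat_powr A (r + 1) ** B)"
    by (subst trace_mul_sym) (simp add: sq A)
  also have "rtr ((B ** B) ** mat_powr A r) = rtr (mat_powr A r ** (B ** B))"
    by (subst trace_mul_sym) simp
  also have "rtr ((B ** A) ** mat_powr B r) = rtr (A ** mat_powr B (r + 1))"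
    by (simp add: matrix_mul_assoc[symmetric] trace_mul_sym[of B]) (simp add: matrix_mul_assoc[symmetric] sq B)
  finally have lhs: "rtr ((A - B) ** (A - B) ** (mat_powr A r + mat_powr B r)) =
      rtr (A ** mat_powr A (r + 1)) - 2 * rtr (mat_powr A (r + 1) ** B) + rtr (mat_powr A r ** (B ** B))
      + rtr (A ** A ** mat_powr B r) - 2 * rtr (A ** mat_powr B (r + 1)) + rtr (B ** mat_powr B (r + 1))"
    by (simp add: sq A B)
  have "rtr ((A - B) ** (mat_powr A (r + 1) - mat_powr B (r + 1))) =
      rtr (A ** mat_powr A (r + 1)) - rtr (mat_powr A (r + 1) ** B) - rtr (A ** mat_powr B (r + 1))
      + rtr (B ** mat_powr B (r + 1))"
    by (simp add: matrix_mult_diff_left matrix_mult_diff_right trace_sub trace_mul_sym[of B "mat_powr A (r + 1)"])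
  with lhs klein show ?thesis by linarith
qed

lemma powr_above_tangent:
  fixes a e r :: real
  assumes r: "1 \<le> r" and a: "0 \<le> a" and e: "0 < e"
  shows "e powr r + r * e powr (r - 1) * (a - e) \<le> a powr r"
proof (cases "a = 0")
  case True
  have "e powr r = e powr (r - 1) * e" using powr_add[of e "r - 1" 1] e by simp
  with True r e show ?thesis by (simp add: mult_right_mono algebra_simps)
next
  case False
  have "r * e powr (r - 1) * (a - e) \<le> a powr r - e powr r"
  proof (rule convex_on_imp_above_tangent[OF powr_convex[OF r]])
    show "((\<lambda>x. x powr r) has_real_derivative r * e powr (r - 1)) (at e within {0<..})"
      using e by (auto intro!: derivative_eq_intros)
  qed (use a False e in \<open>auto simp: interior_open\<close>)
  then show ?thesis by simp
qed

text \<open>Writing \<open>P\<close> for the positive part of \<open>D = A - B\<close>, apply Klein's principle to the tangent line of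
  \<open>t\<^sup>r\<close> at the eigenvalues of \<open>P\<close>: it bounds the right-hand side below by
  \<open>Tr P\<^sup>2\<^sup>+\<^sup>r + r Tr P\<^sup>1\<^sup>+\<^sup>r (A - P)\<close>. The correction is nonnegative, because \<open>P\<^sup>1\<^sup>+\<^sup>r P = P\<^sup>1\<^sup>+\<^sup>r D\<close> turns it into
  \<open>r Tr P\<^sup>1\<^sup>+\<^sup>r B\<close>.\<close>

lemma trace_pos_part_square_mult_powr_ge:
  fixes A B :: "complex^'n^'n"
  assumes r: "1 \<le> r" and A: "positive_semidefinite A" and B: "positive_semidefinite B"
  shows "rtr (mat_powr (pos_part (A - B)) (2 + r)) \<le>
    rtr (pos_part (A - B) ** pos_part (A - B) ** mat_powr A r)"
proof -
  note hA = hermitian_psd[OF A] and hB = hermitian_psd[OF B]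
  define D where "D = A - B"
  define P where "P = pos_part D"
  have h: "hermitian D" unfolding D_def by (rule hermitian_diff[OF hA hB])
  have P: "positive_semidefinite P" unfolding P_def by (rule psd_pos_part[OF h])
  note hP = hermitian_psd[OF P]
  have pw: "e powr (2 + r) = e * e * e powr r" "e powr (1 + r) = e * e powr r"
    "e powr r = e * e powr (r - 1)" if "0 < e" for e :: real
    using that powr_add[of e 2 r] powr_add[of e 1 r] powr_add[of e 1 "r - 1"]
    by (simp_all add: powr_numeral power2_eq_square)
  have scalar: "0 \<le> s * s * t powr r - r * (s powr (1 + r) * t) + (r - 1) * s powr (2 + r)"
    if "0 \<le> s" "0 \<le> t" for s t :: real
  proof (cases "s = 0")
    case False
    with that have s: "0 < s" by simp
    have "s * s * (s powr r + r * s powr (r - 1) * (t - s)) \<le> s * s * t powr r"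
      using powr_above_tangent[OF r that(2) s] by (intro mult_left_mono) auto
    then show ?thesis unfolding pw[OF s] by (simp add: algebra_simps)
  qed auto
  have "0 \<le> (\<Sum>(c, f, g)\<leftarrow>[(1, \<lambda>s. s * s, \<lambda>t. t powr r), (- r, \<lambda>s. s powr (1 + r), \<lambda>t. t),
        (r - 1, \<lambda>s. s powr (2 + r), \<lambda>t. 1)].
      c * rtr (hermitian_fun f P ** hermitian_fun g A))"
    by (rule klein_inequality[OF hP hA]) (use scalar P A in force)
  then have klein: "0 \<le> rtr (P ** P ** mat_powr A r) - r * rtr (mat_powr P (1 + r) ** A)
      + (r - 1) * rtr (mat_powr P (2 + r))"
    using hermitian_fun_id_mult[OF hP, of "\<lambda>t. t"]
    by (simp add: mat_powr_def hermitian_fun_id[OF hP] hermitian_fun_id[OF hA] hermitian_fun_one[OF hA])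
  have PD: "mat_powr P (1 + r) ** D = mat_powr P (2 + r)"
  proof -
    have "hermitian_fun (\<lambda>t. max 0 t powr (1 + r)) D ** D = hermitian_fun (\<lambda>t. max 0 t powr (1 + r) * t) D"
      by (rule hermitian_fun_mult_id[OF h])
    also have "(\<lambda>t. max 0 t powr (1 + r) * t) = (\<lambda>t. max 0 t powr (2 + r))"
    proof
      fix t :: real
      show "max 0 t powr (1 + r) * t = max 0 t powr (2 + r)"
      proof (cases "0 < t")
        case True
        then show ?thesis by (simp add: pw(1,2)[OF True] max_absorb2)
      qed simp
    qed
    finally show ?thesis
      by (simp add: P_def mat_powr_def pos_part_def hermitian_fun_comp[OF h])
  qed
  have "A = D + B" by (simp add: D_def)
  then have "rtr (mat_powr P (1 + r) ** A) = rtr (mat_powr P (2 + r)) + rtr (mat_powr P (1 + r) ** B)"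
    by (simp only: matrix_add_ldistrib trace_add PD plus_complex.simps)
  moreover have "0 \<le> rtr (mat_powr P (1 + r) ** B)"
    by (intro trace_mult_psd_nonneg mat_powr_psd P B)
  ultimately have "rtr (mat_powr P (2 + r)) \<le> rtr (mat_powr P (1 + r) ** A)" by simp
  then have "r * rtr (mat_powr P (2 + r)) \<le> r * rtr (mat_powr P (1 + r) ** A)"
    using r by (intro mult_left_mono) auto
  with klein have "rtr (mat_powr P (2 + r)) \<le> rtr (P ** P ** mat_powr A r)"
    unfolding left_diff_distrib by linarith
  then show ?thesis by (simp only: P_def D_def)
qed

text \<open>With \<open>D = A - B\<close> and \<open>r = p - 2 \<ge> 1\<close>, pass from \<open>D (A\<^sup>r\<^sup>+\<^sup>1 - B\<^sup>r\<^sup>+\<^sup>1)\<close> to \<open>D\<^sup>2 (A\<^sup>r + B\<^sup>r)\<close>. In the latter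
  \<open>D\<^sup>2\<close> is the sum of the squares of the positive and negative parts of \<open>D\<close>; the first is paired with
  \<open>A\<^sup>r\<close>, the second with \<open>B\<^sup>r\<close>, and the two mixed terms are nonnegative.\<close>

lemma trace_diff_mult_powr_diff_ge_convex:
  fixes A B :: "complex^'n^'n"
  assumes p: "3 \<le> p" and A: "positive_semidefinite A" and B: "positive_semidefinite B"
  shows "rtr (mat_powr (mat_abs (A - B)) p) \<le>
    rtr ((A - B) ** (mat_powr A (p - 1) - mat_powr B (p - 1)))"
proof -
  define r where "r = p - 2"
  have r: "1 \<le> r" "2 + r = p" "r + 1 = p - 1" using p by (simp_all add: r_def)
  define D where "D = A - B"
  have h: "hermitian D" unfolding D_def by (intro hermitian_diff hermitian_psd A B)
  have h': "hermitian (- D)" using hermitian_diff[OF hermitian_psd[OF B] hermitian_psd[OF A]] by (simp add: D_def)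
  define P where "P = pos_part D"
  define N where "N = pos_part (- D)"
  have sP: "positive_semidefinite (P ** P)" and sN: "positive_semidefinite (N ** N)"
    unfolding P_def N_def by (intro psd_square hermitian_psd psd_pos_part h h')+
  have "rtr (mat_powr (mat_abs D) p) = rtr (mat_powr P p) + rtr (mat_powr N p)"
    unfolding P_def N_def by (rule trace_abs_powr_split[OF h])
  also have "\<dots> \<le> rtr (P ** P ** mat_powr A r) + rtr (N ** N ** mat_powr B r)"
    using trace_pos_part_square_mult_powr_ge[OF r(1) A B] trace_pos_part_square_mult_powr_ge[OF r(1) B A]
    by (simp add: P_def N_def D_def r)
  also have "\<dots> \<le> rtr (P ** P ** mat_powr A r) + rtr (N ** N ** mat_powr B r)
      + rtr (N ** N ** mat_powr A r) + rtr (P ** P ** mat_powr B r)"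
    using trace_mult_psd_nonneg[OF sN mat_powr_psd[OF A, of r]]
      trace_mult_psd_nonneg[OF sP mat_powr_psd[OF B, of r]] by linarith
  also have "\<dots> = rtr (D ** D ** (mat_powr A r + mat_powr B r))"
    unfolding square_eq_pos_part_squares[OF h] P_def[symmetric] N_def[symmetric]
    by (simp add: matrix_mult_add_left matrix_add_ldistrib trace_add)
  also have "\<dots> \<le> rtr (D ** (mat_powr A (p - 1) - mat_powr B (p - 1)))"
    using trace_diff_mult_powr_diff_ge_square[OF r(1) A B] by (simp add: D_def r)
  finally show ?thesis by (simp add: D_def)
qed

section \<open>The lower bound for exponents between two and three\<close>

text \<open>Two steps for \<open>E = B + P\<close>. First the left-hand side is at most \<open>Tr P\<^sup>2 (E + l)\<inverse>\<close>: by Klein's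
  principle for \<open>E\<close> and \<open>B\<close> this is the scalar inequality
  \<open>l (e - b)\<^sup>2 / ((b + l) (e + l)) \<le> (e - b)\<^sup>2 / (e + l)\<close>. Then \<open>E\<close> is replaced by the smaller \<open>P\<close>.\<close>

lemma trace_resolvent_diff_le_ordered:
  fixes B P :: "complex^'n^'n"
  assumes l: "0 < l" and B: "positive_semidefinite B" and P: "positive_semidefinite P"
  shows "l * rtr (P ** (resolvent l B - resolvent l (B + P))) \<le> rtr (P ** P ** resolvent l P)"
proof -
  define E where "E = B + P"
  have E: "positive_semidefinite E" unfolding E_def by (rule psd_add[OF B P])
  note hB = hermitian_psd[OF B] and hP = hermitian_psd[OF P] and hE = hermitian_psd[OF E]
  have PE: "P = E - B" by (simp add: E_def)
  let ?R = "\<lambda>t. 1 / (t + l)"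
  have scalar: "0 \<le> e * e * ?R e - 2 * (e * ?R e * b) + ?R e * (b * b)
      - l * (e * ?R b) + l * (e * ?R e) + l * (b * ?R b) - l * (?R e * b)"
    if "0 \<le> e" "0 \<le> b" for e b :: real
  proof -
    have pos: "0 < e + l" "0 < b + l" using that l by simp_all
    have "e * e * ?R e - 2 * (e * ?R e * b) + ?R e * (b * b)
        - l * (e * ?R b) + l * (e * ?R e) + l * (b * ?R b) - l * (?R e * b)
        = (e - b)\<^sup>2 * ?R e * (b * ?R b)"
      using pos by (simp add: divide_simps) (simp add: algebra_simps power2_eq_square)
    then show ?thesis using pos that by simp
  qed
  have "0 \<le> (\<Sum>(c, f, g)\<leftarrow>[(1, \<lambda>e. e * e * ?R e, \<lambda>b. 1), (- 2, \<lambda>e. e * ?R e, \<lambda>b. b),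
        (1, ?R, \<lambda>b. b * b), (- l, \<lambda>e. e, ?R), (l, \<lambda>e. e * ?R e, \<lambda>b. 1),
        (l, \<lambda>e. 1, \<lambda>b. b * ?R b), (- l, ?R, \<lambda>b. b)].
      c * rtr (hermitian_fun f E ** hermitian_fun g B))"
    by (rule klein_inequality[OF hE hB]) (use scalar E B in force)
  moreover have "hermitian_fun (\<lambda>e. e * e * ?R e) E = E ** E ** resolvent l E"
    "hermitian_fun (\<lambda>e. e * ?R e) E = E ** resolvent l E"
    "hermitian_fun (\<lambda>b. b * b) B = B ** B"
    "hermitian_fun (\<lambda>b. b * ?R b) B = B ** resolvent l B"
    using hermitian_fun_id_mult[OF hE, of "\<lambda>t. t"] hermitian_fun_id_mult[OF hB, of "\<lambda>t. t"]
      hermitian_fun_mult[OF hE, of "\<lambda>t. t * t" ?R]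
    by (simp_all only: hermitian_fun_id_mult[OF hE] hermitian_fun_id_mult[OF hB]
        hermitian_fun_id[OF hE] hermitian_fun_id[OF hB])
  ultimately have klein: "0 \<le> rtr (E ** E ** resolvent l E) - 2 * rtr (E ** resolvent l E ** B)
      + rtr (resolvent l E ** (B ** B)) - l * rtr (E ** resolvent l B) + l * rtr (E ** resolvent l E)
      + l * rtr (B ** resolvent l B) - l * rtr (resolvent l E ** B)"
    by (simp add: hermitian_fun_id[OF hE] hermitian_fun_id[OF hB] hermitian_fun_one[OF hE] hermitian_fun_one[OF hB])
  have comm: "resolvent l E ** E = E ** resolvent l E"
    by (simp add: hermitian_fun_id_mult[OF hE] hermitian_fun_mult_id[OF hE])
  have "rtr (P ** P ** resolvent l E) = rtr (E ** E ** resolvent l E) - rtr ((E ** B) ** resolvent l E)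
      - rtr (B ** (E ** resolvent l E)) + rtr ((B ** B) ** resolvent l E)"
    unfolding PE by (simp add: matrix_mult_diff_left matrix_mult_diff_right trace_sub matrix_mul_assoc)
  also have "rtr ((E ** B) ** resolvent l E) = rtr (E ** resolvent l E ** B)"
    by (subst trace_mul_sym) (simp add: matrix_mul_assoc comm)
  also have "rtr (B ** (E ** resolvent l E)) = rtr (E ** resolvent l E ** B)"
    by (subst trace_mul_sym) simp
  also have "rtr ((B ** B) ** resolvent l E) = rtr (resolvent l E ** (B ** B))"
    by (subst trace_mul_sym) simp
  finally have sq: "rtr (P ** P ** resolvent l E) = rtr (E ** E ** resolvent l E)
      - 2 * rtr (E ** resolvent l E ** B) + rtr (resolvent l E ** (B ** B))" by simp
  have "rtr (P ** (resolvent l B - resolvent l E)) = rtr (E ** resolvent l B) - rtr (E ** resolvent l E)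
      - rtr (B ** resolvent l B) + rtr (resolvent l E ** B)"
    unfolding PE trace_mul_sym[of "resolvent l E" B]
    by (simp add: matrix_mult_diff_left matrix_mult_diff_right trace_sub)
  then have "l * rtr (P ** (resolvent l B - resolvent l E)) = l * rtr (E ** resolvent l B)
      - l * rtr (E ** resolvent l E) - l * rtr (B ** resolvent l B) + l * rtr (resolvent l E ** B)"
    by (simp only: distrib_left right_diff_distrib)
  with klein sq have "l * rtr (P ** (resolvent l B - resolvent l E)) \<le> rtr (P ** P ** resolvent l E)"
    by linarith
  also have "\<dots> \<le> rtr (P ** P ** resolvent l P)"
  proof (rule trace_mult_mono_right)
    show "positive_semidefinite (resolvent l P - resolvent l E)"
      by (rule resolvent_antimono[OF P _ l]) (simp add: E_def B)
    show "positive_semidefinite (P ** P)"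
      by (rule psd_square[OF hP])
  qed
  finally show ?thesis by (simp add: E_def)
qed

text \<open>The indefinite case follows from the ordered one: with \<open>D = P - N\<close> split into its positive and
  negative part, \<open>A + N = B + P\<close> lies above both \<open>A\<close> and \<open>B\<close>, so in the term paired with \<open>P\<close>
  the resolvent of \<open>A\<close>, and in the term paired with \<open>N\<close> the resolvent of \<open>B\<close>, may be replaced by the
  smaller resolvent of the common upper bound.\<close>

lemma trace_resolvent_diff_le:
  fixes A B :: "complex^'n^'n"
  assumes l: "0 < l" and A: "positive_semidefinite A" and B: "positive_semidefinite B"
  shows "l * rtr ((A - B) ** (resolvent l B - resolvent l A)) \<le>
    rtr (hermitian_fun (\<lambda>t. t * t / (\<bar>t\<bar> + l)) (A - B))"
proof -
  define D where "D = A - B"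
  have h: "hermitian D" unfolding D_def by (intro hermitian_diff hermitian_psd A B)
  have h': "hermitian (- D)"
    using hermitian_diff[OF hermitian_psd[OF B] hermitian_psd[OF A]] by (simp add: D_def)
  define P where "P = pos_part D"
  define N where "N = pos_part (- D)"
  have P: "positive_semidefinite P" and N: "positive_semidefinite N"
    unfolding P_def N_def by (intro psd_pos_part h h')+
  have D: "D = P - N" by (simp add: P_def N_def pos_part_diff[OF h])
  have E: "A + N = B + P" using D by (simp add: D_def algebra_simps)
  have anti: "positive_semidefinite (resolvent l A - resolvent l (B + P))"
    "positive_semidefinite (resolvent l B - resolvent l (B + P))"
    by (rule resolvent_antimono[OF A _ l], simp add: E[symmetric] N)
      (rule resolvent_antimono[OF B _ l], simp add: P)
  have "rtr (D ** (resolvent l B - resolvent l A)) =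
      rtr (P ** (resolvent l B - resolvent l A)) + rtr (N ** (resolvent l A - resolvent l B))"
    unfolding D by (simp add: matrix_mult_diff_left matrix_mult_diff_right trace_sub)
  also have "\<dots> \<le> rtr (P ** (resolvent l B - resolvent l (B + P)))
      + rtr (N ** (resolvent l A - resolvent l (A + N)))"
    unfolding E using trace_mult_psd_nonneg[OF P anti(1)] trace_mult_psd_nonneg[OF N anti(2)]
    by (simp add: matrix_mult_diff_right trace_sub)
  finally have "l * rtr (D ** (resolvent l B - resolvent l A)) \<le>
      l * rtr (P ** (resolvent l B - resolvent l (B + P)))
      + l * rtr (N ** (resolvent l A - resolvent l (A + N)))"
    using mult_left_mono[of _ _ l] l by (fastforce simp: distrib_left)
  also have "\<dots> \<le> rtr (P ** P ** resolvent l P) + rtr (N ** N ** resolvent l N)"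
    by (intro add_mono trace_resolvent_diff_le_ordered A B P N l)
  also have "\<dots> = rtr (P ** P ** resolvent l P + N ** N ** resolvent l N)"
    by (simp add: trace_add)
  also have "P ** P ** resolvent l P + N ** N ** resolvent l N =
      hermitian_fun (\<lambda>t. max 0 t * max 0 t * (1 / (max 0 t + l)) +
        max 0 (- t) * max 0 (- t) * (1 / (max 0 (- t) + l))) D"
    by (simp add: P_def N_def pos_part_def hermitian_fun_uminus[OF h] hermitian_fun_comp[OF h]
        hermitian_fun_mult[OF h] hermitian_fun_add[OF h])
  also have "(\<lambda>t. max 0 t * max 0 t * (1 / (max 0 t + l)) +
        max 0 (- t) * max 0 (- t) * (1 / (max 0 (- t) + l))) = (\<lambda>t. t * t / (\<bar>t\<bar> + l))"
    by (auto simp: fun_eq_iff max_def)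
  finally show ?thesis by (simp add: D_def)
qed

text \<open>Here \<open>t\<^sup>p\<^sup>-\<^sup>1 = t t\<^sup>r\<close> with \<open>0 < r < 1\<close>, a positive mixture of the functions
  \<open>t\<^sup>2 / (t + l) = t - l + l\<^sup>2 / (t + l)\<close>. The difference of the two sides is linear in the function
  \<open>t\<^sup>p\<^sup>-\<^sup>1\<close>. For each single \<open>l\<close> the affine part \<open>t - l\<close> contributes the trace of \<open>D\<^sup>2\<close> to either side,
  and what remains is the resolvent inequality.\<close>

lemma trace_diff_mult_powr_diff_ge_concave:
  fixes A B :: "complex^'n^'n"
  assumes p: "2 < p" "p < 3" and A: "positive_semidefinite A" and B: "positive_semidefinite B"
  shows "rtr (mat_powr (mat_abs (A - B)) p) \<le>
    rtr ((A - B) ** (mat_powr A (p - 1) - mat_powr B (p - 1)))"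
proof -
  define r where "r = p - 2"
  have r: "0 < r" "r < 1" using p by (simp_all add: r_def)
  note hA = hermitian_psd[OF A] and hB = hermitian_psd[OF B]
  define D where "D = A - B"
  have h: "hermitian D" unfolding D_def by (rule hermitian_diff[OF hA hB])
  define M where "M = mat_abs D"
  have M_eq: "M = hermitian_fun abs D" by (simp add: M_def mat_abs_hermitian[OF h])
  have M: "positive_semidefinite M" unfolding M_eq by (rule psd_hermitian_fun[OF h]) simp
  note hM = hermitian_psd[OF M]
  obtain C where C: "C > 0"
    and int: "\<And>t. 0 \<le> t \<Longrightarrow> has_bochner_integral lborel (\<lambda>l. stieltjes r l t) (C * t powr r)"
    using stieltjes_integral[OF r] by blast
  have int': "has_bochner_integral lborel (\<lambda>l. t * stieltjes r l t) (C * t powr (p - 1))"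
    if t: "0 \<le> t" for t
  proof -
    have "t * (C * t powr r) = C * t powr (p - 1)"
      using t powr_add[of t 1 r] by (simp add: r_def)
    with has_bochner_integral_mult_right[OF int[OF t], of t] show ?thesis by (simp only:)
  qed
  \<comment> \<open>The difference of the two sides, with a function \<open>f\<close> in place of the power \<open>p - 1\<close>;
    note that \<open>Tr M\<^sup>p = Tr M M\<^sup>p\<^sup>-\<^sup>1\<close>.\<close>
  define \<Phi> where "\<Phi> f = rtr (D ** hermitian_fun f A) - rtr (D ** hermitian_fun f B)
      - rtr (M ** hermitian_fun f M)" for f
  have nonneg: "0 \<le> \<Phi> (\<lambda>t. t * stieltjes r l t)" for l
  proof (cases "0 < l")
    case l: True
    have eq: "hermitian_fun (\<lambda>t. t * stieltjes r l t) X =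
        l powr (r - 1) *\<^sub>R (X - hermitian_fun (\<lambda>_. l) X + l *\<^sub>R l *\<^sub>R resolvent l X)"
      if X: "positive_semidefinite X" for X :: "complex^'n^'n"
    proof -
      note hX = hermitian_psd[OF X]
      have "t * stieltjes r l t = l powr (r - 1) * (t - l + l * (l * (1 / (t + l))))" if "0 \<le> t" for t
      proof -
        have "t * (t / (t + l)) = t - l + l * (l * (1 / (t + l)))"
          using that l by (simp add: field_simps)
        moreover have "t * stieltjes r l t = l powr (r - 1) * (t * (t / (t + l)))"
          using l by (simp add: stieltjes_def)
        ultimately show ?thesis by (simp only:)
      qed
      then have "hermitian_fun (\<lambda>t. t * stieltjes r l t) X =
          hermitian_fun (\<lambda>t. l powr (r - 1) * (t - l + l * (l * (1 / (t + l))))) X"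
        by (intro hermitian_fun_cong_psd[OF X])
      then show ?thesis
        by (simp only: hermitian_fun_scale[OF hX] hermitian_fun_diff[OF hX, symmetric]
            hermitian_fun_add[OF hX, symmetric] hermitian_fun_id[OF hX])
    qed
    have lin: "D ** hermitian_fun (\<lambda>t. t * stieltjes r l t) A - D ** hermitian_fun (\<lambda>t. t * stieltjes r l t) B =
        l powr (r - 1) *\<^sub>R (D ** D - l *\<^sub>R l *\<^sub>R (D ** (resolvent l B - resolvent l A)))"
    proof -
      have "hermitian_fun (\<lambda>t. t * stieltjes r l t) A - hermitian_fun (\<lambda>t. t * stieltjes r l t) B =
          l powr (r - 1) *\<^sub>R (D - l *\<^sub>R l *\<^sub>R (resolvent l B - resolvent l A))"
        by (simp add: eq A B hermitian_fun_const[OF hA] hermitian_fun_const[OF hB] D_def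
            algebra_simps)
      then show ?thesis
        by (simp add: matrix_mult_diff_right[symmetric, of D "hermitian_fun _ A"] matrix_mult_scaleR_right
            matrix_mult_diff_right[of D D])
    qed
    have "M ** hermitian_fun (\<lambda>t. t * stieltjes r l t) M =
        hermitian_fun (\<lambda>t. l powr (r - 1) * (t * t - l * (t * t / (\<bar>t\<bar> + l)))) D"
    proof -
      have "\<bar>t\<bar> * (\<bar>t\<bar> * stieltjes r l \<bar>t\<bar>) = l powr (r - 1) * (t * t - l * (t * t / (\<bar>t\<bar> + l)))" for t
      proof -
        have "\<bar>t\<bar> + l > 0" using l by simp
        then have "t * t * (\<bar>t\<bar> / (\<bar>t\<bar> + l)) = t * t - l * (t * t / (\<bar>t\<bar> + l))"
          by (simp add: field_simps)
        moreover have "\<bar>t\<bar> * (\<bar>t\<bar> * stieltjes r l \<bar>t\<bar>) =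
            l powr (r - 1) * (\<bar>t\<bar> * \<bar>t\<bar> * (\<bar>t\<bar> / (\<bar>t\<bar> + l)))"
          using l by (simp only: stieltjes_def if_True mult_ac)
        ultimately show ?thesis by (simp only: abs_mult_self_eq)
      qed
      then show ?thesis
        by (simp add: M_eq hermitian_fun_comp[OF h] hermitian_fun_mult[OF h])
    qed
    also have "\<dots> = l powr (r - 1) *\<^sub>R (D ** D - l *\<^sub>R hermitian_fun (\<lambda>t. t * t / (\<bar>t\<bar> + l)) D)"
      using hermitian_fun_id_mult[OF h, of "\<lambda>t. t"]
      by (simp only: hermitian_fun_scale[OF h] hermitian_fun_diff[OF h, symmetric] hermitian_fun_id[OF h])
    finally have absM: "M ** hermitian_fun (\<lambda>t. t * stieltjes r l t) M =
        l powr (r - 1) *\<^sub>R (D ** D - l *\<^sub>R hermitian_fun (\<lambda>t. t * t / (\<bar>t\<bar> + l)) D)" .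
    have "\<Phi> (\<lambda>t. t * stieltjes r l t) = rtr (D ** hermitian_fun (\<lambda>t. t * stieltjes r l t) A -
        D ** hermitian_fun (\<lambda>t. t * stieltjes r l t) B - M ** hermitian_fun (\<lambda>t. t * stieltjes r l t) M)"
      by (simp add: \<Phi>_def trace_sub)
    also have "\<dots> = l powr (r - 1) * (l * (rtr (hermitian_fun (\<lambda>t. t * t / (\<bar>t\<bar> + l)) D)
        - l * rtr (D ** (resolvent l B - resolvent l A))))"
      unfolding lin absM by (simp add: trace_sub rtr_scaleR algebra_simps)
    also have "0 \<le> \<dots>"
      using trace_resolvent_diff_le[OF l A B] l by (simp add: D_def)
    finally show ?thesis .
  next
    case False
    then have "stieltjes r l t = 0" for t by (simp add: stieltjes_def)
    moreover have "real_diag (\<lambda>_. 0) = (0 :: complex^'n^'n)" by (simp add: real_diag_def vec_eq_iff)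
    ultimately show ?thesis
      by (simp add: \<Phi>_def hermitian_fun_const[OF hA] hermitian_fun_const[OF hB] hermitian_fun_const[OF hM]
          trace_def)
  qed
  have "has_bochner_integral lborel (\<lambda>l. \<Phi> (\<lambda>t. t * stieltjes r l t)) (\<Phi> (\<lambda>t. C * t powr (p - 1)))"
    unfolding \<Phi>_def
    by (intro has_bochner_integral_diff has_bochner_integral_trace_hermitian_fun h hM A B M int')
  then have "0 \<le> \<Phi> (\<lambda>t. C * t powr (p - 1))"
    using nonneg by (rule has_bochner_integral_nonneg)
  also have "\<dots> = C * (rtr (D ** (mat_powr A (p - 1) - mat_powr B (p - 1))) - rtr (M ** mat_powr M (p - 1)))"
    by (simp add: \<Phi>_def hermitian_fun_scale[OF hA] hermitian_fun_scale[OF hB] hermitian_fun_scale[OF hM]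
        mat_powr_def matrix_mult_scaleR_right rtr_scaleR matrix_mult_diff_right trace_sub algebra_simps)
  also have "M ** mat_powr M (p - 1) = mat_powr M p"
    using mat_powr_mult[OF M, of 1 "p - 1"] by (simp add: mat_powr_one[OF M])
  finally show ?thesis using C by (simp add: zero_le_mult_iff M_def D_def)
qed

section \<open>The two bounds for exponents at least two\<close>

lemma trace_diff_mult_powr_diff_ge:
  fixes A B :: "complex^'n^'n"
  assumes p: "2 \<le> p" and A: "positive_semidefinite A" and B: "positive_semidefinite B"
  shows "rtr (mat_powr (mat_abs (A - B)) p) \<le>
    rtr ((A - B) ** (mat_powr A (p - 1) - mat_powr B (p - 1)))"
proof -
  consider "p = 2" | "2 < p" "p < 3" | "3 \<le> p" using p by linarith
  then show ?thesis
  proof cases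
    case 1
    define D where "D = A - B"
    have h: "hermitian D" unfolding D_def by (intro hermitian_diff hermitian_psd A B)
    have "mat_powr (mat_abs D) 2 = hermitian_fun (\<lambda>t. t * t) D"
      by (simp add: mat_abs_hermitian[OF h] mat_powr_def hermitian_fun_comp[OF h] powr_numeral
          power2_eq_square)
    also have "\<dots> = D ** D"
      using hermitian_fun_id_mult[OF h, of "\<lambda>t. t"] by (simp add: hermitian_fun_id[OF h])
    finally show ?thesis using 1 by (simp add: D_def mat_powr_one A B)
  next
    case 2
    then show ?thesis by (rule trace_diff_mult_powr_diff_ge_concave[OF _ _ A B])
  next
    case 3
    then show ?thesis by (rule trace_diff_mult_powr_diff_ge_convex[OF _ A B])
  qed
qed

theorem proposition1p1:
  fixes A B :: "complex^'n^'n" and p :: real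
  assumes "p \<ge> 2"
    and "positive_semidefinite A" and "positive_semidefinite B"
  shows "trace (mat_abs (mat_powr A p - mat_powr B p))
      \<ge> trace ((A - B) ** (mat_powr A (p - 1) - mat_powr B (p - 1)))
    \<and> trace ((A - B) ** (mat_powr A (p - 1) - mat_powr B (p - 1)))
      \<ge> trace (mat_powr (mat_abs (A - B)) p)"
proof -
  note A = assms(2) and B = assms(3)
  have D: "hermitian (A - B)" by (intro hermitian_diff hermitian_psd A B)
  have Dr: "hermitian (mat_powr A r - mat_powr B r)" for r
    by (intro hermitian_diff hermitian_psd mat_powr_psd A B)
  have "hermitian (mat_abs (mat_powr A p - mat_powr B p))"
    unfolding mat_abs_hermitian[OF Dr] by (rule hermitian_hermitian_fun[OF Dr])
  moreover have "hermitian (mat_powr (mat_abs (A - B)) p)"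
    unfolding mat_abs_hermitian[OF D] mat_powr_def by (intro hermitian_hermitian_fun D)
  ultimately show ?thesis
    using trace_abs_powr_diff_ge[of p, OF _ A B] trace_diff_mult_powr_diff_ge[OF assms]
      Im_trace_hermitian_mult[OF D Dr] assms(1)
    by (simp add: less_eq_complex_def Im_trace_hermitian)
qed

end
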